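(* Let $s=(s_1,\dots,s_n)$ be a composition and let $\mathcal S_s$ be the fine mixed subdivision of $\square_n+\sum_{k=1}^n(s_k-1)\square_{k-1}\subset\mathbb R^n$ obtained from the DKK triangulation of $\mathcal F_{G_s}$ via the Cayley trick, as described in the context. Then the face poset of the combinatorial $s$-permutahedron is isomorphic to the set of interior cells of $\mathcal S_s$ (cells not contained in the boundary of $\square_n+\sum_{k=1}^n(s_k-1)\square_{k-1}$) ordered by reverse inclusion.
   Context: $s$ is a composition (positive integers). Stirling $s$-permutations: words with each $i\in[n]$ occurring $s_i$ times, avoiding $121$ (no $i<j$ with a $j$ between two $i$'s). The $a$-block of $w$ is the shortest consecutive substring containing all $a$'s. For $a<c$: $(a,c)$ is an ascent if $ac$ is a consecutive substring; $\#_w(c,a)$ is the number of $c$'s preceding the $a$-block. $s$-weak order: $w\le w'$ iff $\#_w(c,a)\le\#_{w'}(c,a)$ for all $a<c$. For a set $A$ of ascents of $w$, $w+A$ is the Stirling $s$-permutation whose inversion numbers form the pointwise smallest function $I$ with $I(c,a)\ge\#_w(c,a)+[(a,c)\in A]$ that is transitive (for $a<b<c$: $I(b,a)=0$ or $I(c,a)\ge I(c,b)$). The combinatorial $s$-permutahedron has faces $(w,A)$ ($w$ a Stirling $s$-permutation, $A$ a set of ascents of $w$), ordered by $(w,A)\le(w',A')$ iff $[w,w+A]\subseteq[w',w'+A']$ in the $s$-weak order. Graph: $s_{n+1}:=2$; $G_s$ has vertices $v_{-1},\dots,v_n$, source-edges $e^i_1,\dots,e^i_{s_i-1}$ from $v_{-1}$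 to $v_{n+1-i}$ ($i\in[1,n+1]$), and for $i\in[1,n]$ bump $e^i_0$ and dip $e^i_{s_i}$ from $v_{n-i}$ to $v_{n+1-i}$. Routes (paths $v_{-1}\to v_n$) are $R(k,t,\delta)=(e^k_t,e^{k-1}_{\delta_{k-1}s_{k-1}},\dots,e^1_{\delta_1s_1})$, $k\in[1,n+1]$, $t\in[1,s_k-1]$, $\delta\in\{0,1\}^{k-1}$. $\mathcal F_{G_s}$ is the unit flow polytope (nonnegative flows, netflow $1$ at $v_{-1}$, $-1$ at $v_n$, $0$ elsewhere), with vertices the route indicator vectors. Framing: incoming edges of $v_{n+1-i}$ ordered by lower index $e^i_0\prec\dots\prec e^i_{s_i}$; outgoing edges of $v_{n+1-i}$ ordered $e^{i-1}_0\prec e^{i-1}_{s_{i-1}}$. Two routes are coherent if, at each maximal common subpath from inner vertex $v_i$ to inner vertex $v_j$, their initial parts up to $v_i$ and final parts from $v_j$ are ordered the same way, where partial routes are compared by the framing order of the edges at the vertex where they last (resp. first) diverge. Cliques are sets of pairwise coherent routes; their convex hulls form the DKK triangulation of $\mathcal F_{G_s}$. Cayley trick: let $p=1+\sum_{i=1}^n(s_i-1)$ be the number of source-edges, and let $\pi:\mathbb R^E\to\mathbb R^p\times\mathbb R^n$ keep the coordinates of the source-edges and of the bumps $e^1_0,\dots,e^n_0$; $\pi$ is injective on the affine hull of $\mathcal F_{G_s}$ and sends $\chi_{R(k,t,\delta)}$ to $(\mathbf e^k_t,\sum_{i\in[k-1],\delta_i=0}\mathbf e_i)$. Hence $\pi(\mathcal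 F_{G_s})$ is the Cayley embedding of one copy of $\square_n$ and $s_k-1$ copies of $\square_{k-1}$ for $k\in[n]$, where $\square_{k-1}=\mathrm{conv}(\{0,1\}^{k-1}\times\{0\}^{n-k+1})\subset\mathbb R^n$. $\mathcal S_s$ is the subdivision obtained by intersecting the images under $\pi$ of the simplices of the DKK triangulation with $\{(1/p,\dots,1/p)\}\times\mathbb R^n$ and dilating by $p$. *)

theory Defs
  imports
    "HOL-Analysis.Analysis"
    "HOL-Library.Function_Algebras"
    "HOL-Library.Sublist"
    "Graph_Theory.Arc_Walk"
begin

text \<open>
  Pointwise real vector space structure on functions, so that convex hulls and Minkowski
  sums apply to coordinate vectors indexed by edges or by natural numbers.
\<close>

instantiation "fun" :: (type, real_vector) real_vector
begin

definition scaleR_fun :: "real \<Rightarrow> ('a \<Rightarrow> 'b) \<Rightarrow> 'a \<Rightarrow> 'b" where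
  "scaleR_fun r f = (\<lambda>x. r *\<^sub>R f x)"

instance
  by standard (simp_all add: scaleR_fun_def fun_eq_iff scaleR_add_right scaleR_add_left)

end

text \<open>
  A composition \<open>(s\<^sub>1, \<dots>, s\<^sub>n)\<close> is a list \<open>s\<close> of positive numbers with \<open>n = length s\<close>.
  The function \<open>part\<close> is 1-based and incorporates the convention \<open>s\<^sub>n\<^sub>+\<^sub>1 = 2\<close>.
\<close>

definition part :: "nat list \<Rightarrow> nat \<Rightarrow> nat" where
  "part s i = (s @ [2]) ! (i - 1)"


section \<open>The combinatorial s-permutahedron\<close>

definition stirling :: "nat list \<Rightarrow> nat list \<Rightarrow> bool" where
  "stirling s w \<longleftrightarrow>
     set w \<subseteq> {1..length s} \<and>
     (\<forall>i\<in>{1..length s}. count_list w i = part s i) \<and>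
     \<not> (\<exists>x y z. x < y \<and> y < z \<and> z < length w \<and> w ! x = w ! z \<and> w ! x < w ! y)"

text \<open>The \<open>a\<close>-block of \<open>w\<close> starts at the first \<open>a\<close>; what precedes it is \<open>takeWhile ((\<noteq>) a) w\<close>.\<close>

definition inv_num :: "nat list \<Rightarrow> nat \<Rightarrow> nat \<Rightarrow> nat" where
  "inv_num w c a = count_list (takeWhile ((\<noteq>) a) w) c"

definition ascents :: "nat list \<Rightarrow> (nat \<times> nat) set" where
  "ascents w = {(a, c). a < c \<and> sublist [a, c] w}"

definition weak_le :: "nat list \<Rightarrow> nat list \<Rightarrow> nat list \<Rightarrow> bool" where
  "weak_le s w w' \<longleftrightarrow>
     (\<forall>a c. 1 \<le> a \<and> a < c \<and> c \<le> length s \<longrightarrow> inv_num w c a \<le> inv_num w' c a)"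

definition weak_interval :: "nat list \<Rightarrow> nat list \<Rightarrow> nat list \<Rightarrow> nat list set" where
  "weak_interval s u v = {w. stirling s w \<and> weak_le s u w \<and> weak_le s w v}"

definition transitive_inv :: "nat list \<Rightarrow> (nat \<Rightarrow> nat \<Rightarrow> nat) \<Rightarrow> bool" where
  "transitive_inv s I \<longleftrightarrow>
     (\<forall>a b c. 1 \<le> a \<and> a < b \<and> b < c \<and> c \<le> length s \<longrightarrow> I b a = 0 \<or> I c b \<le> I c a)"

definition above_asc ::
  "nat list \<Rightarrow> nat list \<Rightarrow> (nat \<times> nat) set \<Rightarrow> (nat \<Rightarrow> nat \<Rightarrow> nat) \<Rightarrow> bool" where
  "above_asc s w A I \<longleftrightarrow>
     (\<forall>a c. 1 \<le> a \<and> a < c \<and> c \<le> length s \<longrightarrow>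
        inv_num w c a + (if (a, c) \<in> A then 1 else 0) \<le> I c a)"

definition plus_asc :: "nat list \<Rightarrow> nat list \<Rightarrow> (nat \<times> nat) set \<Rightarrow> nat list" where
  "plus_asc s w A = (THE u. stirling s u \<and>
     above_asc s w A (inv_num u) \<and> transitive_inv s (inv_num u) \<and>
     (\<forall>I. above_asc s w A I \<and> transitive_inv s I \<longrightarrow>
        (\<forall>a c. 1 \<le> a \<and> a < c \<and> c \<le> length s \<longrightarrow> inv_num u c a \<le> I c a)))"

definition perm_faces :: "nat list \<Rightarrow> (nat list \<times> (nat \<times> nat) set) set" where
  "perm_faces s = {(w, A). stirling s w \<and> A \<subseteq> ascents w}"

definition face_le ::
  "nat list \<Rightarrow> nat list \<times> (nat \<times> nat) set \<Rightarrow> nat list \<times> (nat \<times> nat) set \<Rightarrow> bool" where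
  "face_le s F F' \<longleftrightarrow>
     weak_interval s (fst F) (plus_asc s (fst F) (snd F))
       \<subseteq> weak_interval s (fst F') (plus_asc s (fst F') (snd F'))"


section \<open>The framed graph and its routes\<close>

text \<open>The pair \<open>(i, t)\<close> encodes the edge with upper index \<open>i\<close> and lower index \<open>t\<close>.\<close>

type_synonym edge = "nat \<times> nat"

definition source_edges :: "nat list \<Rightarrow> edge set" where
  "source_edges s = {(i, t). i \<in> {1..length s + 1} \<and> t \<in> {1..part s i - 1}}"

definition bumps :: "nat list \<Rightarrow> edge set" where
  "bumps s = {(i, 0) | i. i \<in> {1..length s}}"

definition dips :: "nat list \<Rightarrow> edge set" where
  "dips s = {(i, part s i) | i. i \<in> {1..length s}}"

definition flow_graph :: "nat list \<Rightarrow> (int, edge) pre_digraph" where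
  "flow_graph s = \<lparr>
     verts = {-1..int (length s)},
     arcs = source_edges s \<union> bumps s \<union> dips s,
     tail = (\<lambda>e. if e \<in> source_edges s then -1 else int (length s) - int (fst e)),
     head = (\<lambda>e. int (length s) + 1 - int (fst e))\<rparr>"

definition inner_verts :: "nat list \<Rightarrow> int set" where
  "inner_verts s = verts (flow_graph s) - {-1, int (length s)}"

definition routes :: "nat list \<Rightarrow> edge list set" where
  "routes s = {P. pre_digraph.apath (flow_graph s) (-1) P (int (length s))}"

text \<open>
  The framing: both the incoming and the outgoing edges of an inner vertex share their upper index
  and are ordered by their lower index.
\<close>

definition in_less :: "nat list \<Rightarrow> edge \<Rightarrow> edge \<Rightarrow> bool" where
  "in_less s e f \<longleftrightarrow> head (flow_graph s) e = head (flow_graph s) f \<and> snd e < snd f"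

definition out_less :: "nat list \<Rightarrow> edge \<Rightarrow> edge \<Rightarrow> bool" where
  "out_less s e f \<longleftrightarrow> tail (flow_graph s) e = tail (flow_graph s) f \<and> snd e < snd f"

definition initial_less :: "nat list \<Rightarrow> edge list \<Rightarrow> edge list \<Rightarrow> bool" where
  "initial_less s P Q \<longleftrightarrow>
     (\<exists>P' Q' R e f. P = P' @ e # R \<and> Q = Q' @ f # R \<and> in_less s e f)"

definition final_less :: "nat list \<Rightarrow> edge list \<Rightarrow> edge list \<Rightarrow> bool" where
  "final_less s P Q \<longleftrightarrow>
     (\<exists>P' Q' R e f. P = R @ e # P' \<and> Q = R @ f # Q' \<and> out_less s e f)"

text \<open>
  \<open>M\<close> is a maximal common subpath of \<open>P = P1 @ M @ P2\<close> and \<open>Q = Q1 @ M @ Q2\<close> from \<open>u\<close> to \<open>v\<close>.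
  It may consist of a single vertex (\<open>M = []\<close>, \<open>u = v\<close>).
\<close>

definition max_common_subpath ::
  "nat list \<Rightarrow> int \<Rightarrow> int \<Rightarrow> edge list \<Rightarrow> edge list \<Rightarrow> edge list \<Rightarrow> edge list \<Rightarrow> edge list \<Rightarrow> bool" where
  "max_common_subpath s u v M P1 P2 Q1 Q2 \<longleftrightarrow>
     u \<in> inner_verts s \<and> v \<in> inner_verts s \<and>
     pre_digraph.awalk (flow_graph s) (-1) P1 u \<and> pre_digraph.awalk (flow_graph s) (-1) Q1 u \<and>
     pre_digraph.awalk (flow_graph s) u M v \<and>
     pre_digraph.awalk (flow_graph s) v P2 (int (length s)) \<and>
     pre_digraph.awalk (flow_graph s) v Q2 (int (length s)) \<and>
     last P1 \<noteq> last Q1 \<and> hd P2 \<noteq> hd Q2"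

definition coherent_routes :: "nat list \<Rightarrow> edge list \<Rightarrow> edge list \<Rightarrow> bool" where
  "coherent_routes s P Q \<longleftrightarrow>
     (\<forall>u v M P1 P2 Q1 Q2.
        P = P1 @ M @ P2 \<and> Q = Q1 @ M @ Q2 \<and> max_common_subpath s u v M P1 P2 Q1 Q2 \<longrightarrow>
        (initial_less s P1 Q1 \<longleftrightarrow> final_less s P2 Q2))"

definition clique :: "nat list \<Rightarrow> edge list set \<Rightarrow> bool" where
  "clique s K \<longleftrightarrow> K \<subseteq> routes s \<and> pairwise (coherent_routes s) K"

definition route_vec :: "edge list \<Rightarrow> edge \<Rightarrow> real" where
  "route_vec P = (\<lambda>e. if e \<in> set P then 1 else 0)"

text \<open>All simplices of the triangulation, not only the maximal ones.\<close>

definition DKK_triangulation :: "nat list \<Rightarrow> (edge \<Rightarrow> real) set set" where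
  "DKK_triangulation s = {convex hull (route_vec ` K) | K. clique s K}"


section \<open>The Cayley trick\<close>

text \<open>
  The space \<open>\<real>\<^sup>n\<close> is the carrier of \<open>Euclidean_space n\<close>, so its coordinates are 0-based: the
  coordinate of the bump with upper index \<open>i + 1\<close> is \<open>x i\<close>. The other factor consists of the
  functions supported on the source-edges.
\<close>

definition num_sources :: "nat list \<Rightarrow> nat" where
  "num_sources s = 1 + (\<Sum>i = 1..length s. part s i - 1)"

definition cayley_proj :: "nat list \<Rightarrow> (edge \<Rightarrow> real) \<Rightarrow> (edge \<Rightarrow> real) \<times> (nat \<Rightarrow> real)" where
  "cayley_proj s f =
     (\<lambda>e. if e \<in> source_edges s then f e else 0,
      \<lambda>i. if i < length s then f (Suc i, 0) else 0)"

definition cayley_slice :: "nat list \<Rightarrow> ((edge \<Rightarrow> real) \<times> (nat \<Rightarrow> real)) set" where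
  "cayley_slice s =
     {\<lambda>e. if e \<in> source_edges s then 1 / real (num_sources s) else 0}
       \<times> topspace (Euclidean_space (length s))"

definition mixed_cell :: "nat list \<Rightarrow> (edge \<Rightarrow> real) set \<Rightarrow> (nat \<Rightarrow> real) set" where
  "mixed_cell s \<Delta> =
     (\<lambda>y. real (num_sources s) *\<^sub>R snd y) ` (cayley_proj s ` \<Delta> \<inter> cayley_slice s)"

definition mixed_subdivision :: "nat list \<Rightarrow> (nat \<Rightarrow> real) set set" where
  "mixed_subdivision s = mixed_cell s ` DKK_triangulation s"

definition cube :: "nat \<Rightarrow> (nat \<Rightarrow> real) set" where
  "cube k = convex hull {x. (\<forall>i<k. x i \<in> {0, 1}) \<and> (\<forall>i\<ge>k. x i = 0)}"

definition cube_sum :: "nat list \<Rightarrow> (nat \<Rightarrow> real) set" where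
  "cube_sum s = cube (length s) + (\<Sum>k = 1..length s. \<Sum>t = 1..part s k - 1. cube (k - 1))"

definition interior_cells :: "nat list \<Rightarrow> (nat \<Rightarrow> real) set set" where
  "interior_cells s =
     {C \<in> mixed_subdivision s. \<not> C \<subseteq> Euclidean_space (length s) frontier_of cube_sum s}"

end

theory Submission
  imports Defs
begin

text \<open>
  Write a route as the vector of lower indices of its edges, indexed by upper index. Two routes are
  coherent iff their vectors are comparable in every common coordinate. A prefix of a Stirling
  permutation \<open>w\<close> has a vector of letter counts, and truncating it at the first letter that has
  started but not ended gives a route; the routes of all prefixes form the maximal clique of \<open>w\<close>. The
  face \<open>(w, A)\<close> corresponds to the subclique that omits the prefixes ending inside an ascent of \<open>A\<close>.

  A route belongs to the clique of \<open>u\<close> iff certain single inversion numbers of \<open>u\<close> satisfy upper and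
  lower bounds. Hence the words whose clique contains a given clique \<open>K\<close> are described by a lower and
  an upper bound for the inversion function. If \<open>K\<close> uses every edge of the graph, both bounds are
  transitive and planar, hence inversion functions of words \<open>w\<close> and \<open>w + A\<close>, and \<open>K\<close> is the
  intersection of the cliques of these two words. So inclusion of intervals is reverse inclusion of
  cliques.

  On the geometric side, a flow has at most one representation as a positive combination of a clique,
  because its minimal route can be read off greedily from the flow. So inclusion of cells is inclusion
  of cliques. The Minkowski sum of cubes is a coordinate box, and a cell avoids all its facets iff every
  bump and every dip occurs in the clique.
\<close>

section \<open>Stirling permutations and inversion numbers\<close>

text \<open>A source-edge is a label strictly between \<open>0\<close> and \<open>part s i\<close>,
  that is, a letter that is open (started, not finished). While \<open>k\<close> is open no larger
  letter can be read, so truncating at the lowest open letter \<open>k\<close> drops only frozen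
  counts, and distinct prefixes keep distinct routes. The letter \<open>n + 1\<close> is a sentinel
  that is always open: it serves the prefixes without any open letter.

  A label \<open>0\<close> at \<open>a\<close> places the prefix before the \<open>a\<close>-block,
  a full label places it after the block; hence one-sided bounds on \<open>inv_num w c a\<close>.
  Transitivity and planarity say that the counts in front of the \<open>a\<close>-block come from a
  prefix of the word on the letters above \<open>a\<close>, so a word can be built by inserting its
  letters in decreasing order.

  Only ascents can be skipped by a covering clique: its edges force the routes at both ends of the
  word and between equal letters, and the choice of the least word forces those at descents.

  The obstacle is that comparability on common coordinates is not transitive, because routes have
  different lengths; the minimum of a clique needs an argument on cycles of three routes.\<close>

abbreviation cnt :: "nat list \<Rightarrow> nat \<Rightarrow> nat \<Rightarrow> nat" where
  "cnt w p c \<equiv> count_list (take p w) c"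

lemma cnt_Suc: "p < length w \<Longrightarrow> cnt w (Suc p) c = cnt w p c + (if w ! p = c then 1 else 0)"
  by (simp add: take_Suc_conv_app_nth)

lemma cnt_mono: "p \<le> q \<Longrightarrow> cnt w p c \<le> cnt w q c"
  by (metis count_list_append le_add1 le_Suc_ex take_add)

lemma cnt_le: "cnt w p c \<le> count_list w c"
  by (metis append_take_drop_id count_list_append le_add1)

text \<open>A prefix that contains a \<open>b\<close> reaches past the start of the
  \<open>b\<close>-block, so it contains every letter counted by
  \<open>inv_num w c b\<close>.\<close>

lemma inv_num_le_cnt: "0 < cnt w p b \<Longrightarrow> inv_num w c b \<le> cnt w p c"
proof -
  assume "0 < cnt w p b"
  then have "b \<in> set (take p w)"
    using count_list_0_iff by force
  then have "takeWhile ((\<noteq>) b) (take p w @ drop p w) = takeWhile ((\<noteq>) b) (take p w)"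
    by (intro takeWhile_append1) auto
  then show ?thesis
    unfolding inv_num_def
    by (metis append_take_drop_id count_list_append le_add1 takeWhile_dropWhile_id)
qed

text \<open>The pattern condition of \<open>stirling\<close> on its own, so that it also applies to
  words on an upper part of the alphabet.\<close>

definition avoids_121 :: "nat list \<Rightarrow> bool" where
  "avoids_121 w \<longleftrightarrow>
     \<not> (\<exists>x y z. x < y \<and> y < z \<and> z < length w \<and> w ! x = w ! z \<and> w ! x < w ! y)"

lemma avoids_121_iff_split:
  "avoids_121 w \<longleftrightarrow> (\<forall>u c v a. w = u @ c # v \<longrightarrow> a < c \<longrightarrow> a \<in> set u \<longrightarrow> a \<notin> set v)"
proof (intro iffI allI impI)
  fix u c v a
  assume w: "avoids_121 w" "w = u @ c # v" "a < c" "a \<in> set u"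
  show "a \<notin> set v"
  proof
    assume "a \<in> set v"
    then obtain i j where ij: "i < length u" "u ! i = a" "j < length v" "v ! j = a"
      using w(4) by (metis in_set_conv_nth)
    have "i < length u \<and> length u < length u + 1 + j \<and> length u + 1 + j < length w
      \<and> w ! i = w ! (length u + 1 + j) \<and> w ! i < w ! length u"
      using ij w by (simp add: nth_append)
    then show False
      using w(1) unfolding avoids_121_def by blast
  qed
next
  assume split: "\<forall>u c v a. w = u @ c # v \<longrightarrow> a < c \<longrightarrow> a \<in> set u \<longrightarrow> a \<notin> set v"
  show "avoids_121 w"
    unfolding avoids_121_def
  proof (intro notI, elim exE conjE)
    fix x y z
    assume xyz: "x < y" "y < z" "z < length w" "w ! x = w ! z" "w ! x < w ! y"
    have "w = take y w @ w ! y # drop (Suc y) w"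
      using xyz by (simp add: id_take_nth_drop)
    moreover have "w ! x \<in> set (take y w)"
      using xyz by (auto simp: in_set_conv_nth intro!: exI[of _ x])
    moreover have "w ! x \<in> set (drop (Suc y) w)"
      using xyz by (auto simp: in_set_conv_nth intro!: exI[of _ "z - Suc y"])
    ultimately show False
      using split xyz(5) by blast
  qed
qed

text \<open>A larger \<open>c\<close> cannot lie inside the \<open>b\<close>-block, so as long as
  copies of \<open>b\<close> remain, all copies of \<open>c\<close> read so far precede that
  block.\<close>

lemma cnt_le_inv_num:
  assumes "avoids_121 w" "b < c" "cnt w p b < count_list w b"
  shows "cnt w p c \<le> inv_num w c b"
proof (cases "b \<in> set (take p w)")
  case False
  then have "takeWhile ((\<noteq>) b) (take p w @ drop p w) = take p w @ takeWhile ((\<noteq>) b) (drop p w)"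
    by (intro takeWhile_append2) auto
  then show ?thesis
    unfolding inv_num_def by (simp del: takeWhile_append)
next
  case True
  then obtain x1 x2 where x: "take p w = x1 @ b # x2" "b \<notin> set x1"
    by (meson split_list_first)
  have "count_list (drop p w) b \<noteq> 0"
    using assms(3) by (metis append_take_drop_id count_list_append add_0_right less_irrefl)
  then have b: "b \<in> set (drop p w)"
    by (simp add: count_list_0_iff)
  have "c \<notin> set x2"
  proof
    assume "c \<in> set x2"
    then obtain y1 y2 where "x2 = y1 @ c # y2"
      by (meson split_list)
    then have "w = (x1 @ b # y1) @ c # (y2 @ drop p w)"
      using x(1) by (metis append.assoc append_Cons append_take_drop_id)
    then show False
      using assms(1,2) b unfolding avoids_121_iff_split by (metis Un_iff in_set_conv_decomp set_append)
  qed
  then have "count_list x2 c = 0"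
    by (simp add: count_list_0_iff)
  moreover have "takeWhile ((\<noteq>) b) w = x1"
  proof -
    have "takeWhile ((\<noteq>) b) (x1 @ b # x2 @ drop p w) = x1"
      using x(2) by (subst takeWhile_append2) auto
    then show ?thesis
      using x(1) by (metis append.assoc append_Cons append_take_drop_id)
  qed
  ultimately show ?thesis
    using assms(2) x(1) by (simp add: inv_num_def)
qed

section \<open>Words with prescribed counts and prescribed inversion numbers\<close>

locale composition =
  fixes s :: "nat list"
  assumes pos: "\<forall>k\<in>set s. 0 < k"
begin

abbreviation n where "n \<equiv> length s"

lemma part_last [simp]: "part s (Suc n) = 2"
  by (simp add: part_def nth_append)

lemma part_pos: "1 \<le> i \<Longrightarrow> i \<le> Suc n \<Longrightarrow> 0 < part s i"
  using pos by (auto simp: part_def nth_append)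

definition stirling_from :: "nat \<Rightarrow> nat list \<Rightarrow> bool" where
  "stirling_from m w \<longleftrightarrow>
     set w \<subseteq> {m..n} \<and> (\<forall>i\<in>{m..n}. count_list w i = part s i) \<and> avoids_121 w"

lemma stirling_iff: "stirling s w \<longleftrightarrow> stirling_from 1 w"
  by (simp add: stirling_def stirling_from_def avoids_121_def)

lemma cnt_le_part: "stirling_from m w \<Longrightarrow> c \<in> {m..n} \<Longrightarrow> cnt w p c \<le> part s c"
  unfolding stirling_from_def by (metis cnt_le)

lemma cnt_le_inv:
  assumes "stirling_from m w" "m \<le> b" "b < c" "c \<le> n" "cnt w p b < part s b"
  shows "cnt w p c \<le> inv_num w c b"
  using assms by (intro cnt_le_inv_num) (auto simp: stirling_from_def)

text \<open>The prefix is the shortest one that contains at least \<open>r c\<close> copies of every \<open>c \<in> S\<close>.\<close>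

lemma prefix_with_counts:
  assumes w: "stirling_from m w" and S: "S \<subseteq> {m..n}"
    and r: "\<And>c. c \<in> S \<Longrightarrow> r c \<le> part s c"
    and lower: "\<And>b c. b \<in> S \<Longrightarrow> c \<in> S \<Longrightarrow> b < c \<Longrightarrow> 0 < r b \<Longrightarrow> inv_num w c b \<le> r c"
    and upper: "\<And>b c. b \<in> S \<Longrightarrow> c \<in> S \<Longrightarrow> b < c \<Longrightarrow> r b < part s b \<Longrightarrow> r c \<le> inv_num w c b"
  shows "\<exists>p\<le>length w. \<forall>c\<in>S. cnt w p c = r c"
proof -
  define Q where "Q p \<longleftrightarrow> (\<forall>c\<in>S. r c \<le> cnt w p c)" for p
  define p where "p = (LEAST p. Q p)"
  have full: "Q (length w)"
    using r S w by (auto simp: Q_def stirling_from_def)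
  then have p: "Q p" "p \<le> length w"
    unfolding p_def by (auto intro: LeastI Least_le)
  have "cnt w p c = r c" if c: "c \<in> S" for c
  proof (rule ccontr)
    assume "cnt w p c \<noteq> r c"
    then have gt: "r c < cnt w p c"
      using p c by (force simp: Q_def)
    then obtain q where q: "p = Suc q"
      by (cases p) auto
    have "\<not> Q q"
      using not_less_Least[of q Q] q by (simp add: p_def)
    then obtain b where b: "b \<in> S" "cnt w q b < r b"
      by (auto simp: Q_def not_le)
    have step: "cnt w p i = cnt w q i + (if w ! q = i then 1 else 0)" for i
      using p(2) q by (simp add: cnt_Suc)
    have "r b \<le> cnt w p b"
      using p(1) b by (auto simp: Q_def)
    then have wq: "w ! q = b" "Suc (cnt w q b) = r b"
      using step[of b] b by (auto split: if_splits)
    have bc: "b \<noteq> c"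
      using gt step[of b] wq by auto
    then have cq: "cnt w p c = cnt w q c"
      using step[of c] wq by simp
    \<comment> \<open>Before its last letter \<open>b\<close> is read, the prefix still lacks
      \<open>b\<close> and already has \<open>c\<close> in excess. Whichever of the two is smaller,
      its state bounds the count of the other.\<close>
    consider "b < c" | "c < b" using bc by linarith
    then show False
    proof cases
      case 1
      have "cnt w q c \<le> inv_num w c b"
        using b r[OF b(1)] c S 1 by (intro cnt_le_inv[OF w]) (force, auto)
      then show False
        using lower[OF b(1) c 1] gt cq wq by linarith
    next
      case 2
      have "r c < part s c"
        using gt cnt_le_part[OF w, of c p] c S by force
      moreover have "inv_num w b c \<le> cnt w q b"
        using gt cq by (intro inv_num_le_cnt) linarith
      ultimately show False
        using upper[OF c b(1) 2] b by linarith
    qed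
  qed
  then show ?thesis
    using p(2) by blast
qed

text \<open>
  Since \<open>m\<close> is the least letter, its copies are consecutive, and inserting them is the same as
  choosing a prefix of a word on the remaining letters.
\<close>

lemma avoids_121_insert_least:
  assumes "avoids_121 (x @ y)" "\<forall>c\<in>set (x @ y). m < c"
  shows "avoids_121 (x @ replicate k m @ y)"
  unfolding avoids_121_iff_split
proof (intro allI impI notI)
  fix u c v a
  assume w: "x @ replicate k m @ y = u @ c # v" and ac: "a < c" and a: "a \<in> set u" "a \<in> set v"
  have "set (x @ replicate k m @ y) \<subseteq> insert m (set (x @ y))"
    by auto
  then have "a \<in> insert m (set (x @ y))"
    using a w by auto
  then have "m \<le> a"
    using assms(2) by (auto dest: less_imp_le)
  have "filter ((\<noteq>) m) (x @ replicate k m @ y) = x @ y"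
    using assms(2) by (auto simp: filter_id_conv intro!: arg_cong2[of _ _ _ _ append])
  then have xy: "x @ y = filter ((\<noteq>) m) u @ c # filter ((\<noteq>) m) v"
    using w \<open>m \<le> a\<close> ac by simp
  \<comment> \<open>For \<open>a\<close> different from \<open>m\<close> the pattern survives the
    deletion of all \<open>m\<close>; for \<open>a = m\<close> the copies are consecutive, so
    nothing larger lies between two of them.\<close>
  show False
  proof (cases "a = m")
    case False
    then show False
      using a assms(1)[unfolded avoids_121_iff_split, rule_format, OF xy ac] by auto
  next
    case True
    let ?w = "x @ replicate k m @ y"
    obtain i j where ij: "i < length u" "u ! i = m" "j < length v" "v ! j = m"
      using a True by (metis in_set_conv_nth)
    have pos_m: "length x \<le> l \<and> l < length x + k" if "l < length ?w" "?w ! l = m" for l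
    proof (rule ccontr)
      assume "\<not> ?thesis"
      then have "?w ! l \<in> set (x @ y)"
        using that(1) by (auto simp: nth_append split: if_splits)
      then show False
        using assms(2) that(2) by auto
    qed
    have "length x \<le> i"
      using pos_m[of i] ij w by (auto simp: nth_append)
    moreover have "length u + 1 + j < length x + k"
      using pos_m[of "length u + 1 + j"] ij w by (auto simp: nth_append)
    ultimately have "length x \<le> length u" "length u - length x < k"
      using ij(1) by linarith+
    then have "?w ! length u = m"
      by (simp add: nth_append)
    then show False
      using w ac True by (simp add: nth_append)
  qed
qed

text \<open>With \<open>r c = I c m\<close>, transitivity and planarity at \<open>a = m\<close> are
  the hypotheses \<open>lower\<close> and \<open>upper\<close> of \<open>prefix_with_counts\<close>
  for the word on the letters above \<open>m\<close>; the block of \<open>m\<close> goes right after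
  the prefix obtained. Hence the induction runs downwards from \<open>Suc n\<close>.\<close>

lemma exists_stirling_from:
  assumes "m \<le> Suc n" "1 \<le> m"
    and le: "\<And>a c. m \<le> a \<Longrightarrow> a < c \<Longrightarrow> c \<le> n \<Longrightarrow> I c a \<le> part s c"
    and trans: "\<And>a b c. m \<le> a \<Longrightarrow> a < b \<Longrightarrow> b < c \<Longrightarrow> c \<le> n \<Longrightarrow> 0 < I b a \<Longrightarrow> I c b \<le> I c a"
    and planar: "\<And>a b c. m \<le> a \<Longrightarrow> a < b \<Longrightarrow> b < c \<Longrightarrow> c \<le> n \<Longrightarrow> I b a < part s b \<Longrightarrow> I c a \<le> I c b"
  shows "\<exists>w. stirling_from m w \<and> (\<forall>a c. m \<le> a \<longrightarrow> a < c \<longrightarrow> c \<le> n \<longrightarrow> inv_num w c a = I c a)"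
  using assms
proof (induction m rule: inc_induct)
  case base
  then show ?case
    by (intro exI[of _ "[]"]) (auto simp: stirling_from_def avoids_121_def)
next
  case (step m)
  have "\<exists>w. stirling_from (Suc m) w \<and>
      (\<forall>a c. Suc m \<le> a \<longrightarrow> a < c \<longrightarrow> c \<le> n \<longrightarrow> inv_num w c a = I c a)"
    by (rule step.IH) (use step.prems in auto)
  then obtain w where w: "stirling_from (Suc m) w"
    and inv: "\<And>a c. Suc m \<le> a \<Longrightarrow> a < c \<Longrightarrow> c \<le> n \<Longrightarrow> inv_num w c a = I c a"
    by blast
  have "\<exists>p\<le>length w. \<forall>c\<in>{Suc m..n}. cnt w p c = I c m"
    using w inv step.prems by (intro prefix_with_counts) auto
  then obtain p where p: "p \<le> length w" "\<And>c. m < c \<Longrightarrow> c \<le> n \<Longrightarrow> cnt w p c = I c m"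
    by auto
  define w' where "w' = take p w @ replicate (part s m) m @ drop p w"
  have count: "count_list w' c = count_list w c + (if c = m then part s m else 0)" for c
  proof -
    have "count_list (replicate k m) c = (if c = m then k else 0)" for k
      by (induction k) auto
    moreover have "count_list w c = cnt w p c + count_list (drop p w) c"
      by (metis append_take_drop_id count_list_append)
    ultimately show ?thesis
      by (simp add: w'_def)
  qed
  have notin: "m \<notin> set w" and gt: "\<forall>c\<in>set w. m < c"
    using w by (auto simp: stirling_from_def)
  then have count_m: "count_list w m = 0"
    by (simp add: count_list_0_iff)
  have "avoids_121 w'"
    using w gt unfolding w'_def
    by (intro avoids_121_insert_least) (auto simp: stirling_from_def)
  moreover have "set w' \<subseteq> {m..n}"
  proof -
    have "set w' \<subseteq> insert m (set w)"
      by (auto simp: w'_def dest: in_set_takeD in_set_dropD)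
    moreover have "insert m (set w) \<subseteq> {m..n}"
      using w step.hyps by (auto simp: stirling_from_def)
    ultimately show ?thesis
      by (rule subset_trans)
  qed
  ultimately have st: "stirling_from m w'"
    using count w count_m by (auto simp: stirling_from_def)
  have filter_w': "filter ((\<noteq>) m) w' = w"
  proof -
    have "filter ((\<noteq>) m) w' = filter ((\<noteq>) m) (take p w @ drop p w)"
      unfolding w'_def filter_append by simp
    then show ?thesis
      using notin by (auto simp only: append_take_drop_id filter_id_conv)
  qed
  have "inv_num w' c a = I c a" if ac: "m \<le> a" "a < c" "c \<le> n" for a c
  proof (cases "a = m")
    case True
    have "takeWhile ((\<noteq>) m) w' = take p w"
    proof -
      \<comment> \<open>The block must be nonempty for \<open>takeWhile\<close> to stop at the
        insertion point.\<close>
      have "part s m = Suc (part s m - 1)"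
        using part_pos[of m] step.prems step.hyps by auto
      then have "replicate (part s m) m = m # replicate (part s m - 1) m"
        by (metis replicate_Suc)
      then show ?thesis
        using notin unfolding w'_def by (subst takeWhile_append2) (auto dest: in_set_takeD)
    qed
    then show ?thesis
      using True p(2)[of c] ac by (simp add: inv_num_def)
  next
    case False
    have "count_list (takeWhile ((\<noteq>) a) (filter ((\<noteq>) m) v)) c = count_list (takeWhile ((\<noteq>) a) v) c" for v
      using False ac by (induction v) auto
    then have "inv_num w' c a = inv_num w c a"
      unfolding inv_num_def by (metis filter_w')
    then show ?thesis
      using inv ac False by auto
  qed
  then show ?case
    using st by blast
qed

text \<open>The counts of a prefix of \<open>u\<close> satisfy the bounds of
  \<open>prefix_with_counts\<close> for \<open>v\<close>, and its length is the sum of its counts.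
  So prefixes of equal length have equal counts, and consecutive prefixes reveal the
  letters.\<close>

lemma stirling_eqI:
  assumes u: "stirling s u" and v: "stirling s v"
    and eq: "\<And>a c. 1 \<le> a \<Longrightarrow> a < c \<Longrightarrow> c \<le> n \<Longrightarrow> inv_num u c a = inv_num v c a"
  shows "u = v"
proof -
  note u' = u[unfolded stirling_iff] and v' = v[unfolded stirling_iff]
  have len: "length w = (\<Sum>c\<in>{1..n}. count_list w c)" if "set w \<subseteq> {1..n}" for w
    using that
  proof (induction w)
    case (Cons a w)
    have "(\<Sum>c\<in>{1..n}. count_list (a # w) c) = (\<Sum>c\<in>{1..n}. count_list w c + (if c = a then 1 else 0))"
      by (rule sum.cong) auto
    then show ?case
      using Cons by (simp add: sum.distrib)
  qed simp
  have sub: "set u \<subseteq> {1..n}" "set v \<subseteq> {1..n}"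
    using u' v' by (auto simp: stirling_from_def)
  have lens: "length u = length v"
    using u' v' len[OF sub(1)] len[OF sub(2)] by (simp add: stirling_from_def)
  have cnt_eq: "cnt u p c = cnt v p c" if p: "p \<le> length u" and c: "c \<in> {1..n}" for p c
  proof -
    have "\<exists>q\<le>length v. \<forall>c\<in>{1..n}. cnt v q c = cnt u p c"
    proof (rule prefix_with_counts[OF v' subset_refl])
      fix c assume "c \<in> {1..n}" then show "cnt u p c \<le> part s c" by (rule cnt_le_part[OF u'])
    next
      fix b c assume "b \<in> {1..n}" "c \<in> {1..n}" "b < c" "0 < cnt u p b"
      then show "inv_num v c b \<le> cnt u p c"
        using eq[of b c] inv_num_le_cnt[of p u b c] by auto
    next
      fix b c assume "b \<in> {1..n}" "c \<in> {1..n}" "b < c" "cnt u p b < part s b"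
      then show "cnt u p c \<le> inv_num v c b"
        using eq[of b c] cnt_le_inv[OF u', of b c p] by auto
    qed
    then obtain q where q: "q \<le> length v" "\<forall>c\<in>{1..n}. cnt v q c = cnt u p c"
      by blast
    have "p = length (take p u)" using p by simp
    also have "\<dots> = (\<Sum>c\<in>{1..n}. cnt u p c)"
      using sub by (intro len) (auto dest: in_set_takeD)
    also have "\<dots> = (\<Sum>c\<in>{1..n}. cnt v q c)"
      using q by simp
    also have "\<dots> = length (take q v)"
      using sub by (intro len[symmetric]) (auto dest: in_set_takeD)
    finally have "p = q" using q by simp
    then show ?thesis using q c by simp
  qed
  show ?thesis
  proof (rule nth_equalityI[OF lens])
    fix i assume i: "i < length u"
    then have "u ! i \<in> {1..n}" using sub(1) nth_mem by blast
    then have "cnt u (Suc i) (u ! i) = cnt v (Suc i) (u ! i)" "cnt u i (u ! i) = cnt v i (u ! i)"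
      using cnt_eq i by auto
    then show "u ! i = v ! i"
      using i lens by (auto simp: cnt_Suc split: if_splits)
  qed
qed

end

section \<open>Routes and coherence\<close>

text \<open>A change of sign between two vectors can be found with equality strictly in between; for
  routes, this stretch becomes a maximal common subpath.\<close>

lemma adjacent_crossing:
  fixes f g :: "nat \<Rightarrow> nat"
  assumes "j < i" "f j \<noteq> g j" "f i \<noteq> g i" "(f i < g i) \<noteq> (f j < g j)"
  shows "\<exists>j' i'. j \<le> j' \<and> j' < i' \<and> i' \<le> i \<and> f j' \<noteq> g j' \<and> f i' \<noteq> g i' \<and>
    (f i' < g i') \<noteq> (f j' < g j') \<and> (\<forall>l. j' < l \<and> l < i' \<longrightarrow> f l = g l)"
  using assms
proof (induction "i - j" arbitrary: i j rule: less_induct)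
  case less
  show ?case
  proof (cases "\<exists>l. j < l \<and> l < i \<and> f l \<noteq> g l")
    case False
    then show ?thesis using less.prems by (intro exI[of _ j] exI[of _ i]) auto
  next
    case True
    then obtain l where l: "j < l" "l < i" "f l \<noteq> g l" by blast
    show ?thesis
    proof (cases "(f l < g l) = (f j < g j)")
      case True
      have "i - l < i - j" using l by linarith
      from less.hyps[OF this l(2,3) less.prems(3)] True less.prems(4)
      obtain j' i' where "l \<le> j'" "j' < i'" "i' \<le> i" "f j' \<noteq> g j'" "f i' \<noteq> g i'"
        "(f i' < g i') \<noteq> (f j' < g j')" "\<forall>k. j' < k \<and> k < i' \<longrightarrow> f k = g k"
        by blast
      then show ?thesis
        using l(1) by (intro exI[of _ j'] exI[of _ i']) simp
    next
      case False
      have "l - j < i - j" using l by linarith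
      from less.hyps[OF this l(1) less.prems(2) l(3)] False
      obtain j' i' where "j \<le> j'" "j' < i'" "i' \<le> l" "f j' \<noteq> g j'" "f i' \<noteq> g i'"
        "(f i' < g i') \<noteq> (f j' < g j')" "\<forall>k. j' < k \<and> k < i' \<longrightarrow> f k = g k"
        by blast
      then show ?thesis
        using l(2) by (intro exI[of _ j'] exI[of _ i']) simp
    qed
  qed
qed

lemma initial_less_iff:
  assumes "P \<noteq> []" "Q \<noteq> []" "last P \<noteq> last Q"
  shows "initial_less s P Q \<longleftrightarrow> in_less s (last P) (last Q)"
proof
  assume "initial_less s P Q"
  then obtain P' Q' R e f where *: "P = P' @ e # R" "Q = Q' @ f # R" "in_less s e f"
    by (auto simp: initial_less_def)
  with assms(3) have "R = []" by (cases R rule: rev_cases) auto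
  then show "in_less s (last P) (last Q)" using * by simp
next
  assume "in_less s (last P) (last Q)"
  then show "initial_less s P Q"
    unfolding initial_less_def using assms(1,2) append_butlast_last_id by metis
qed

lemma final_less_iff:
  assumes "P \<noteq> []" "Q \<noteq> []" "hd P \<noteq> hd Q"
  shows "final_less s P Q \<longleftrightarrow> out_less s (hd P) (hd Q)"
proof
  assume "final_less s P Q"
  then obtain P' Q' R e f where *: "P = R @ e # P'" "Q = R @ f # Q'" "out_less s e f"
    by (auto simp: final_less_def)
  with assms(3) have "R = []" by (cases R) auto
  then show "out_less s (hd P) (hd Q)" using * by simp
next
  assume "out_less s (hd P) (hd Q)"
  then have "P = [] @ hd P # tl P \<and> Q = [] @ hd Q # tl Q \<and> out_less s (hd P) (hd Q)"
    using assms by simp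
  then show "final_less s P Q"
    unfolding final_less_def by blast
qed

text \<open>The edges of a route have upper indices \<open>length P, \<dots>, 1\<close> in this order.\<close>

definition lab :: "edge list \<Rightarrow> nat \<Rightarrow> nat" where
  "lab P i = snd (P ! (length P - i))"

text \<open>Only common coordinates are compared, so the relation need not be transitive: a short
  route can lie between two long ones that are not comparable.\<close>

definition below :: "edge list \<Rightarrow> edge list \<Rightarrow> bool" where
  "below P Q \<longleftrightarrow> (\<forall>i. 1 \<le> i \<and> i \<le> length P \<and> i \<le> length Q \<longrightarrow> lab P i \<le> lab Q i)"

lemma cas_append:
  "xs \<noteq> [] \<Longrightarrow> pre_digraph.cas G u (xs @ ys) v \<longleftrightarrow>
     pre_digraph.cas G u xs (head G (last xs)) \<and> pre_digraph.cas G (head G (last xs)) ys v"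
  by (induction xs arbitrary: u) (auto simp: pre_digraph.cas.simps)

section \<open>Routes as vectors of lower indices\<close>

context composition
begin

abbreviation "G \<equiv> flow_graph s"

lemma arcs_cases:
  assumes "e \<in> arcs G"
  obtains "e \<in> source_edges s" "tail G e = -1" "1 \<le> fst e" "fst e \<le> Suc n" "0 < snd e" "snd e < part s (fst e)"
    | "e \<notin> source_edges s" "tail G e = int n - int (fst e)" "1 \<le> fst e" "fst e \<le> n"
      "snd e \<in> {0, part s (fst e)}"
proof (cases "e \<in> source_edges s")
  case True
  then show ?thesis
    using that(1) by (auto simp: flow_graph_def source_edges_def)
next
  case False
  then show ?thesis
    using assms that(2) by (auto simp: flow_graph_def bumps_def dips_def)
qed

lemma head_G: "head G e = int n + 1 - int (fst e)"
  by (simp add: flow_graph_def)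

lemma source_edge_iff:
  "e \<in> source_edges s \<longleftrightarrow> 1 \<le> fst e \<and> fst e \<le> Suc n \<and> 0 < snd e \<and> snd e < part s (fst e)"
  by (cases e) (auto simp: source_edges_def)

lemma inner_arcI:
  assumes "1 \<le> fst e" "fst e \<le> n" "snd e \<in> {0, part s (fst e)}"
  shows "e \<in> arcs G" "tail G e = int n - int (fst e)"
proof -
  have "e \<notin> source_edges s"
    using assms by (auto simp: source_edge_iff)
  then show "e \<in> arcs G" "tail G e = int n - int (fst e)"
    using assms by (cases e; auto simp: flow_graph_def bumps_def dips_def)+
qed

lemma source_arcI: "e \<in> source_edges s \<Longrightarrow> e \<in> arcs G \<and> tail G e = -1"
  by (simp add: flow_graph_def)

text \<open>Since \<open>m \<le> n\<close>, the walk does not start at the source, so it contains no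
  source-edge; each step is a bump or a dip and lowers the upper index by one.\<close>

lemma inner_walk_iff:
  assumes "m \<le> n"
  shows "set P \<subseteq> arcs G \<and> pre_digraph.cas G (int n - int m) P (int n) \<longleftrightarrow>
    length P = m \<and> (\<forall>i. 1 \<le> i \<and> i \<le> m \<longrightarrow> fst (P ! (m - i)) = i \<and> snd (P ! (m - i)) \<in> {0, part s i})"
  using assms
proof (induction P arbitrary: m)
  case Nil
  then show ?case by (auto simp: pre_digraph.cas.simps)
next
  case (Cons e P)
  show ?case (is "?L \<longleftrightarrow> ?R")
  proof
    assume L: ?L
    then have e: "e \<in> arcs G" "tail G e = int n - int m"
      and P: "set P \<subseteq> arcs G" "pre_digraph.cas G (head G e) P (int n)"
      by (auto simp: pre_digraph.cas.simps)
    have fe: "fst e = m" "1 \<le> m" "snd e \<in> {0, part s m}"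
      using e(1) by (rule arcs_cases; use e(2) Cons.prems in auto)+
    then have "pre_digraph.cas G (int n - int (m - 1)) P (int n)"
      using P(2) by (simp add: head_G of_nat_diff algebra_simps)
    with P Cons.IH[of "m - 1"] Cons.prems
    have IH: "length P = m - 1"
      "\<And>i. 1 \<le> i \<Longrightarrow> i \<le> m - 1 \<Longrightarrow> fst (P ! (m - 1 - i)) = i \<and> snd (P ! (m - 1 - i)) \<in> {0, part s i}"
      by auto
    show ?R
    proof (intro conjI allI impI)
      show "length (e # P) = m" using IH fe by simp
    next
      fix i assume i: "1 \<le> i \<and> i \<le> m"
      have "(e # P) ! (m - i) = (if i = m then e else P ! (m - 1 - i))"
        using i by (simp add: nth_Cons')
      moreover have "i \<noteq> m \<Longrightarrow> i \<le> m - 1" using i by linarith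
      ultimately show "fst ((e # P) ! (m - i)) = i" "snd ((e # P) ! (m - i)) \<in> {0, part s i}"
        using i fe IH(2)[of i] by (cases "i = m", simp, simp)+
    qed
  next
    assume R: ?R
    then have m: "length P = m - 1" "1 \<le> m" by auto
    have e: "fst e = m" "snd e \<in> {0, part s m}"
      using R m by auto
    have "fst (P ! (m - 1 - i)) = i \<and> snd (P ! (m - 1 - i)) \<in> {0, part s i}"
      if "1 \<le> i" "i \<le> m - 1" for i
    proof -
      have "m - i = Suc (m - 1 - i)"
        using that m by linarith
      then have "(e # P) ! (m - i) = P ! (m - 1 - i)"
        by simp
      moreover have "i \<le> m" using that by simp
      ultimately show ?thesis using R that(1) by metis
    qed
    then have "set P \<subseteq> arcs G \<and> pre_digraph.cas G (int n - int (m - 1)) P (int n)"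
      using Cons.IH[of "m - 1"] Cons.prems m by auto
    moreover have "int n - int (m - 1) = head G e"
      using m e by (simp add: head_G of_nat_diff)
    ultimately show ?L
      using inner_arcI[of e] e m Cons.prems by (auto simp: pre_digraph.cas.simps)
  qed
qed

lemma routes_iff:
  "P \<in> routes s \<longleftrightarrow> 1 \<le> length P \<and> length P \<le> Suc n \<and>
     (\<forall>i. 1 \<le> i \<and> i \<le> length P \<longrightarrow> fst (P ! (length P - i)) = i) \<and>
     0 < lab P (length P) \<and> lab P (length P) < part s (length P) \<and>
     (\<forall>i. 1 \<le> i \<and> i < length P \<longrightarrow> lab P i \<in> {0, part s i})" (is "_ \<longleftrightarrow> ?R")
proof (cases P)
  case Nil
  then show ?thesis
    by (auto simp: routes_def pre_digraph.apath_def pre_digraph.awalk_def pre_digraph.cas.simps)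
next
  case (Cons e Q)
  have nthQ: "P ! (length P - i) = Q ! (length Q - i)" if "1 \<le> i" "i \<le> length Q" for i
    using that Cons by (simp add: nth_Cons' Suc_diff_le)
  show ?thesis
  proof
    assume "P \<in> routes s"
    then have P: "set P \<subseteq> arcs G" "pre_digraph.cas G (-1) P (int n)"
      by (auto simp: routes_def pre_digraph.apath_def pre_digraph.awalk_def)
    then have e: "e \<in> arcs G" "tail G e = -1"
      and Q: "set Q \<subseteq> arcs G" "pre_digraph.cas G (head G e) Q (int n)"
      using Cons by (auto simp: pre_digraph.cas.simps)
    have fe: "1 \<le> fst e" "fst e \<le> Suc n" "0 < snd e" "snd e < part s (fst e)"
      using e(1) by (rule arcs_cases; use e(2) in auto)+
    then have "pre_digraph.cas G (int n - int (fst e - 1)) Q (int n)"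
      using Q(2) by (simp add: head_G of_nat_diff algebra_simps)
    then have len: "length Q = fst e - 1"
      and IH: "\<And>i. 1 \<le> i \<Longrightarrow> i \<le> length Q \<Longrightarrow> fst (Q ! (length Q - i)) = i \<and> snd (Q ! (length Q - i)) \<in> {0, part s i}"
      using Q(1) inner_walk_iff[of "fst e - 1" Q] fe by auto
    have top: "P ! (length P - length P) = e" "length P = fst e"
      using Cons len fe by auto
    show ?R
    proof (intro conjI allI impI)
      fix i assume i: "1 \<le> i \<and> i \<le> length P"
      show "fst (P ! (length P - i)) = i"
      proof (cases "i = length P")
        case False
        then have "1 \<le> i" "i \<le> length Q" using i Cons by auto
        then show ?thesis using nthQ IH by metis
      qed (use top in simp)
    next
      fix i assume i: "1 \<le> i \<and> i < length P"
      show "lab P i \<in> {0, part s i}"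
        using i IH[of i] nthQ[of i] Cons unfolding lab_def by auto
    qed (use top fe in \<open>auto simp: lab_def\<close>)
  next
    assume R: ?R
    have top: "P ! (length P - length P) = e" using Cons by simp
    have fe: "fst e = length P"
      using R top by (metis le_refl)
    then have src: "e \<in> source_edges s"
      using R top by (auto simp: source_edge_iff lab_def)
    have "fst (Q ! (length Q - i)) = i \<and> snd (Q ! (length Q - i)) \<in> {0, part s i}"
      if i: "1 \<le> i" "i \<le> length Q" for i
    proof -
      have "i \<le> length P" "i < length P" using i Cons by auto
      then show ?thesis using R i(1) nthQ[OF i] unfolding lab_def by metis
    qed
    then have "set Q \<subseteq> arcs G \<and> pre_digraph.cas G (int n - int (length Q)) Q (int n)"
      using inner_walk_iff[of "length Q" Q] R Cons by auto
    moreover have "int n - int (length Q) = head G e"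
      using fe Cons by (simp add: head_G)
    ultimately have P: "set P \<subseteq> arcs G" "pre_digraph.cas G (-1) P (int n)"
      using source_arcI[OF src] Cons by (auto simp: pre_digraph.cas.simps)
    have hd_P: "tail G (hd P) = -1"
      using source_arcI[OF src] Cons by simp
    have head_nth: "head G (P ! x) = int n + 1 - int (length P) + int x" if "x < length P" for x
    proof -
      have "1 \<le> length P - x" "length P - x \<le> length P" using that by auto
      then have "fst (P ! (length P - (length P - x))) = length P - x" using R by blast
      then show ?thesis using that by (simp add: head_G of_nat_diff)
    qed
    \<comment> \<open>\<open>apath\<close> asks for distinct vertices: the heads advance by one
      along the route and never return to the source.\<close>
    have "distinct (map (head G) P)"
      by (auto simp: distinct_conv_nth head_nth)
    moreover have "-1 \<notin> set (map (head G) P)"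
    proof
      assume "-1 \<in> set (map (head G) P)"
      then obtain e' where "e' \<in> set P" "head G e' = -1"
        by auto
      then obtain x where "x < length P" "head G (P ! x) = -1"
        by (metis in_set_conv_nth)
      then show False using R head_nth[of x] by linarith
    qed
    ultimately have "distinct (pre_digraph.awalk_verts G (-1) P)"
      using pre_digraph.awalk_verts_conv'[OF P(2)] hd_P by auto
    then show "P \<in> routes s"
      using P by (auto simp: routes_def pre_digraph.apath_def pre_digraph.awalk_def flow_graph_def)
  qed
qed

lemma route_length: "P \<in> routes s \<Longrightarrow> 1 \<le> length P \<and> length P \<le> Suc n"
  by (simp add: routes_iff)

lemma route_top: "P \<in> routes s \<Longrightarrow> 0 < lab P (length P) \<and> lab P (length P) < part s (length P)"
  by (simp add: routes_iff)

lemma route_inner: "P \<in> routes s \<Longrightarrow> 1 \<le> i \<Longrightarrow> i < length P \<Longrightarrow> lab P i = 0 \<or> lab P i = part s i"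
  by (simp add: routes_iff)

lemma route_nth: "P \<in> routes s \<Longrightarrow> 1 \<le> i \<Longrightarrow> i \<le> length P \<Longrightarrow> P ! (length P - i) = (i, lab P i)"
  by (simp add: routes_iff lab_def prod_eq_iff)

lemma lab_le_part: "P \<in> routes s \<Longrightarrow> 1 \<le> i \<Longrightarrow> i \<le> length P \<Longrightarrow> lab P i \<le> part s i"
  using route_top[of P] route_inner[of P i] by (cases "i = length P") auto

lemma edge_mem_route_iff:
  assumes "P \<in> routes s"
  shows "(i, t) \<in> set P \<longleftrightarrow> 1 \<le> i \<and> i \<le> length P \<and> lab P i = t"
proof
  assume "(i, t) \<in> set P"
  then obtain x where x: "x < length P" "P ! x = (i, t)"
    by (auto simp: in_set_conv_nth)
  have "P ! (length P - (length P - x)) = (length P - x, lab P (length P - x))"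
    using x(1) by (intro route_nth[OF assms]) auto
  then show "1 \<le> i \<and> i \<le> length P \<and> lab P i = t"
    using x by auto
next
  assume "1 \<le> i \<and> i \<le> length P \<and> lab P i = t"
  then have "P ! (length P - i) = (i, t)" "length P - i < length P"
    using route_nth[OF assms] by auto
  then show "(i, t) \<in> set P"
    by (metis nth_mem)
qed

text \<open>Equality of lengths comes for free: at its top coordinate the shorter route has a label
  strictly between \<open>0\<close> and \<open>part s i\<close>, where the longer one could only
  have an extreme label.\<close>

lemma route_eqI:
  assumes P: "P \<in> routes s" and Q: "Q \<in> routes s"
    and eq: "\<And>i. 1 \<le> i \<Longrightarrow> i \<le> length P \<Longrightarrow> i \<le> length Q \<Longrightarrow> lab P i = lab Q i"
  shows "P = Q"
proof -
  have len: "length P = length Q"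
  proof (rule ccontr)
    assume "length P \<noteq> length Q"
    then consider "length P < length Q" | "length Q < length P" by linarith
    then show False
    proof cases
      case 1
      then show False
        using route_top[OF P] route_inner[OF Q, of "length P"] eq[of "length P"] route_length[OF P] by auto
    next
      case 2
      then show False
        using route_top[OF Q] route_inner[OF P, of "length Q"] eq[of "length Q"] route_length[OF Q] by auto
    qed
  qed
  show ?thesis
  proof (rule nth_equalityI[OF len])
    fix x assume x: "x < length P"
    then show "P ! x = Q ! x"
      using route_nth[OF P, of "length P - x"] route_nth[OF Q, of "length P - x"] eq[of "length P - x"] len
      by auto
  qed
qed

lemma route_exists:
  assumes "1 \<le> k" "k \<le> Suc n" "0 < r k" "r k < part s k"
    "\<And>i. 1 \<le> i \<Longrightarrow> i < k \<Longrightarrow> r i = 0 \<or> r i = part s i"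
  shows "\<exists>P\<in>routes s. length P = k \<and> (\<forall>i. 1 \<le> i \<and> i \<le> k \<longrightarrow> lab P i = r i)"
proof -
  define P where "P = map (\<lambda>x. (k - x, r (k - x))) [0..<k]"
  have len: "length P = k" by (simp add: P_def)
  have nth: "P ! (k - i) = (i, r i)" if "1 \<le> i" "i \<le> k" for i
    using that by (simp add: P_def)
  then have "lab P i = r i" if "1 \<le> i" "i \<le> k" for i
    using that by (simp add: lab_def len)
  moreover from this have "P \<in> routes s"
    using assms by (simp add: routes_iff len nth)
  ultimately show ?thesis using len by blast
qed

lemma finite_routes: "finite (routes s)"
proof -
  have "finite (arcs G)"
  proof -
    have "source_edges s = Sigma {1..n + 1} (\<lambda>i. {1..part s i - 1})"
      by (auto simp: source_edges_def)
    then show ?thesis by (simp add: flow_graph_def bumps_def dips_def)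
  qed
  moreover have "routes s \<subseteq> {P. set P \<subseteq> arcs G \<and> length P \<le> Suc n}"
    using route_length by (auto simp: routes_def pre_digraph.apath_def pre_digraph.awalk_def)
  ultimately show ?thesis
    using finite_subset[OF _ finite_lists_length_le] by blast
qed

section \<open>Coherence as comparability of label vectors\<close>

lemma route_split:
  assumes P: "P \<in> routes s" and eq: "P = P1 @ M @ P2" and "P1 \<noteq> []" "P2 \<noteq> []"
  shows "last P1 = (length M + length P2 + 1, lab P (length M + length P2 + 1))"
    and "hd P2 = (length P2, lab P (length P2))"
proof -
  have "last P1 = P ! (length P - (length M + length P2 + 1))"
    using assms(3) by (simp add: eq last_conv_nth nth_append)
  then show "last P1 = (length M + length P2 + 1, lab P (length M + length P2 + 1))"
    using assms(3) by (subst (asm) route_nth[OF P]) (auto simp: eq Suc_le_eq)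
  have "hd P2 = P ! (length P - length P2)"
    using assms(4) by (simp add: eq hd_conv_nth nth_append)
  then show "hd P2 = (length P2, lab P (length P2))"
    using assms(4) by (subst (asm) route_nth[OF P]) (auto simp: eq Suc_le_eq)
qed

text \<open>The edges entering and leaving a maximal common subpath belong to one coordinate each,
  so the two framing comparisons are comparisons of labels, and these go the same way.\<close>

lemma coherent_if_below:
  assumes P: "P \<in> routes s" and Q: "Q \<in> routes s" and "below P Q \<or> below Q P"
  shows "coherent_routes s P Q"
  unfolding coherent_routes_def
proof (intro allI impI, elim conjE)
  fix u v M P1 P2 Q1 Q2
  assume eqP: "P = P1 @ M @ P2" and eqQ: "Q = Q1 @ M @ Q2"
    and max: "max_common_subpath s u v M P1 P2 Q1 Q2"
  have u: "u \<noteq> -1" and v: "v \<noteq> int n" "v \<noteq> -1"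
    and w1: "pre_digraph.cas G (-1) P1 u" "pre_digraph.cas G (-1) Q1 u"
    and w2: "pre_digraph.cas G v P2 (int n)" "pre_digraph.cas G v Q2 (int n)"
    and sub: "set P2 \<subseteq> arcs G" "set Q2 \<subseteq> arcs G"
    and ne: "last P1 \<noteq> last Q1" "hd P2 \<noteq> hd Q2"
    using max by (auto simp: max_common_subpath_def inner_verts_def pre_digraph.awalk_def)
  have nonempty: "P1 \<noteq> []" "Q1 \<noteq> []" "P2 \<noteq> []" "Q2 \<noteq> []"
    using u v w1 w2 by (auto simp: pre_digraph.cas.simps)
  note sP = route_split[OF P eqP nonempty(1,3)] and sQ = route_split[OF Q eqQ nonempty(2,4)]
  have tails: "tail G (hd P2) = v" "tail G (hd Q2) = v"
    using w2 nonempty by (cases P2; cases Q2; simp add: pre_digraph.cas.simps)+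
  have tail_hd: "int n - int (fst (hd R)) = v" if "R \<noteq> []" "set R \<subseteq> arcs G" "tail G (hd R) = v" for R
  proof -
    have "hd R \<in> arcs G" using that by auto
    then show ?thesis by (rule arcs_cases) (use that v in auto)
  qed
  \<comment> \<open>Both final parts leave the same vertex \<open>v\<close>, which aligns the
    coordinates of the two routes.\<close>
  have len: "length P2 = length Q2"
    using tail_hd[OF nonempty(3) sub(1) tails(1)] tail_hd[OF nonempty(4) sub(2) tails(2)] sP(2) sQ(2)
    by simp
  let ?i = "length M + length P2 + 1" and ?j = "length P2"
  have bounds: "1 \<le> ?i" "?i \<le> length P" "?i \<le> length Q" "1 \<le> ?j" "?j \<le> length P" "?j \<le> length Q"
    using nonempty len by (auto simp: eqP eqQ Suc_le_eq)
  have "in_less s (last P1) (last Q1) \<longleftrightarrow> lab P ?i < lab Q ?i"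
    using sP(1) sQ(1) len by (simp add: in_less_def head_G)
  moreover have "out_less s (hd P2) (hd Q2) \<longleftrightarrow> lab P ?j < lab Q ?j"
    using sP(2) sQ(2) len tails by (simp add: out_less_def)
  moreover have "lab P ?i \<noteq> lab Q ?i" "lab P ?j \<noteq> lab Q ?j"
    using ne sP sQ len by auto
  moreover have "lab P ?i \<le> lab Q ?i \<and> lab P ?j \<le> lab Q ?j \<or> lab Q ?i \<le> lab P ?i \<and> lab Q ?j \<le> lab P ?j"
    using assms(3) bounds unfolding below_def by blast
  ultimately show "initial_less s P1 Q1 \<longleftrightarrow> final_less s P2 Q2"
    using initial_less_iff[OF nonempty(1,2) ne(1)] final_less_iff[OF nonempty(3,4) ne(2)] by auto
qed

text \<open>Cuts a route after its edge of upper index \<open>i\<close> and before that of upper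
  index \<open>j\<close>. Upper indices decrease along a route, so the edge of index
  \<open>i\<close> sits at position \<open>length P - i\<close>.\<close>

lemma route_pieces:
  assumes P: "P \<in> routes s" and ij: "1 \<le> j" "j < i" "i \<le> length P"
  defines "P1 \<equiv> take (Suc (length P) - i) P"
    and "M \<equiv> take (i - Suc j) (drop (Suc (length P) - i) P)" and "P2 \<equiv> drop (length P - j) P"
  shows "P = P1 @ M @ P2" "last P1 = (i, lab P i)" "hd P2 = (j, lab P j)"
    "pre_digraph.awalk G (-1) P1 (int n + 1 - int i)"
    "pre_digraph.awalk G (int n + 1 - int i) M (int n - int j)"
    "pre_digraph.awalk G (int n - int j) P2 (int n)"
    "M = map (\<lambda>x. (i - 1 - x, lab P (i - 1 - x))) [0..<i - Suc j]"
proof -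
  have lens: "length M = i - Suc j" "length P2 = j" "P1 \<noteq> []" "P2 \<noteq> []"
    using ij by (auto simp: P1_def M_def P2_def)
  have "drop (i - Suc j) (drop (Suc (length P) - i) P) = P2"
    using ij by (simp add: P2_def)
  then show eq: "P = P1 @ M @ P2"
    unfolding P1_def M_def by (metis append_take_drop_id)
  show last: "last P1 = (i, lab P i)" and hd: "hd P2 = (j, lab P j)"
    using route_split[OF P eq lens(3,4)] lens ij by auto
  have walk: "set P \<subseteq> arcs G" "pre_digraph.cas G (-1) P (int n)"
    using P by (auto simp: routes_def pre_digraph.apath_def pre_digraph.awalk_def)
  then have sub: "set P1 \<subseteq> arcs G" "set M \<subseteq> arcs G" "set P2 \<subseteq> arcs G"
    using eq by auto
  have c1: "pre_digraph.cas G (-1) P1 (int n + 1 - int i)"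
    "pre_digraph.cas G (int n + 1 - int i) (M @ P2) (int n)"
    using walk(2) cas_append[OF lens(3), of G "-1" "M @ P2"] last eq by (auto simp: head_G)
  have c2: "pre_digraph.cas G (int n + 1 - int i) M (int n - int j) \<and>
    pre_digraph.cas G (int n - int j) P2 (int n)"
  proof (cases "M = []")
    case True
    then have "i = Suc j" using lens ij by simp
    then show ?thesis using c1(2) True by (simp add: pre_digraph.cas.simps)
  next
    case False
    have "last M = P ! (length P - Suc j)"
    proof -
      have "length M - 1 < i - Suc j" using False lens(1) by (cases "i - Suc j") auto
      moreover have "M ! y = P ! (Suc (length P) - i + y)" if "y < i - Suc j" for y
        using that ij by (simp add: M_def)
      ultimately have "last M = P ! (Suc (length P) - i + (length M - 1))"
        using last_conv_nth[OF False] by simp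
      also have "Suc (length P) - i + (length M - 1) = length P - Suc j"
        using lens(1) ij \<open>length M - 1 < i - Suc j\<close> by linarith
      finally show ?thesis .
    qed
    then have "head G (last M) = int n - int j"
      using route_nth[OF P, of "Suc j"] ij by (simp add: head_G)
    then show ?thesis
      using c1(2) cas_append[OF False, of G _ P2] by metis
  qed
  have "i \<le> Suc n" using route_length[OF P] ij by simp
  then show "pre_digraph.awalk G (-1) P1 (int n + 1 - int i)"
    "pre_digraph.awalk G (int n + 1 - int i) M (int n - int j)"
    "pre_digraph.awalk G (int n - int j) P2 (int n)"
    using c1 c2 sub ij by (auto simp: pre_digraph.awalk_def flow_graph_def)
  show "M = map (\<lambda>x. (i - 1 - x, lab P (i - 1 - x))) [0..<i - Suc j]"
  proof (rule nth_equalityI)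
    fix x assume "x < length M"
    then have x: "x < i - Suc j" using lens by simp
    then have "M ! x = P ! (length P - (i - 1 - x))"
      using ij by (simp add: M_def)
    also have "\<dots> = (i - 1 - x, lab P (i - 1 - x))"
      using x ij by (intro route_nth[OF P]) auto
    finally show "M ! x = map (\<lambda>x. (i - 1 - x, lab P (i - 1 - x))) [0..<i - Suc j] ! x"
      using x by simp
  qed (simp add: lens)
qed

text \<open>If neither route is below the other, there are two coordinates of opposite sign; taken
  adjacent, they enclose a maximal common subpath, possibly a single vertex, at which coherence
  fails.\<close>

lemma coherent_iff_below:
  assumes P: "P \<in> routes s" and Q: "Q \<in> routes s"
  shows "coherent_routes s P Q \<longleftrightarrow> below P Q \<or> below Q P"
proof (intro iffI)
  assume coh: "coherent_routes s P Q"
  show "below P Q \<or> below Q P"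
  proof (rule ccontr)
    assume "\<not> (below P Q \<or> below Q P)"
    then obtain x y where xy: "1 \<le> x" "x \<le> length P" "x \<le> length Q" "lab P x < lab Q x"
      "1 \<le> y" "y \<le> length P" "y \<le> length Q" "lab Q y < lab P y"
      unfolding below_def not_le by (auto simp: not_le)
    then have "x \<noteq> y" by auto
    have "\<exists>j i. min x y \<le> j \<and> j < i \<and> i \<le> max x y \<and> lab P j \<noteq> lab Q j \<and> lab P i \<noteq> lab Q i \<and>
      (lab P i < lab Q i) \<noteq> (lab P j < lab Q j) \<and> (\<forall>l. j < l \<and> l < i \<longrightarrow> lab P l = lab Q l)"
      using xy \<open>x \<noteq> y\<close> by (intro adjacent_crossing) (auto simp: min_def max_def)
    then obtain i j where ij0: "min x y \<le> j" "i \<le> max x y" and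
      ij1: "j < i" "lab P j \<noteq> lab Q j" "lab P i \<noteq> lab Q i" "(lab P i < lab Q i) \<noteq> (lab P j < lab Q j)"
      and between: "\<And>l. j < l \<Longrightarrow> l < i \<Longrightarrow> lab P l = lab Q l"
      by blast
    have "1 \<le> j" "i \<le> length P" "i \<le> length Q"
      using ij0 xy by linarith+
    note ij = this(1) ij1(1) this(2,3) ij1(2-4)
    note p = route_pieces[OF P ij(1,2,3)] and q = route_pieces[OF Q ij(1,2,4)]
    let ?P1 = "take (Suc (length P) - i) P" and ?P2 = "drop (length P - j) P"
    let ?Q1 = "take (Suc (length Q) - i) Q" and ?Q2 = "drop (length Q - j) Q"
    define M where "M = take (i - Suc j) (drop (Suc (length P) - i) P)"
    have M: "M = take (i - Suc j) (drop (Suc (length Q) - i) Q)"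
      unfolding M_def p(7) q(7) using between by auto
    have bnd: "i \<le> Suc n" using route_length[OF P] ij by simp
    have ne: "?P1 \<noteq> []" "?Q1 \<noteq> []" "?P2 \<noteq> []" "?Q2 \<noteq> []"
      using ij by auto
    have ne2: "last ?P1 \<noteq> last ?Q1" "hd ?P2 \<noteq> hd ?Q2"
      using ij p(2,3) q(2,3) by auto
    have "max_common_subpath s (int n + 1 - int i) (int n - int j) M ?P1 ?P2 ?Q1 ?Q2"
      unfolding max_common_subpath_def
      using p q bnd ij ne2 by (auto simp: inner_verts_def flow_graph_def M_def)
    then have "initial_less s ?P1 ?Q1 \<longleftrightarrow> final_less s ?P2 ?Q2"
      using coh p(1) q(1) unfolding coherent_routes_def M_def[symmetric] M[symmetric] by blast
    then have "in_less s (last ?P1) (last ?Q1) \<longleftrightarrow> out_less s (hd ?P2) (hd ?Q2)"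
      using initial_less_iff[OF ne(1,2) ne2(1)] final_less_iff[OF ne(3,4) ne2(2)] by simp
    moreover have "tail G (hd ?P2) = tail G (hd ?Q2)"
      using p(3,6) q(3,6) ne unfolding pre_digraph.awalk_def
      by (metis hd_Cons_tl pre_digraph.cas.simps(2))
    ultimately show False
      using ij p(2,3) q(2,3) by (simp add: in_less_def out_less_def head_G)
  qed
qed (rule coherent_if_below[OF assms])

text \<open>Around the cycle all labels shared by the three routes coincide. The top label of the
  shortest one is not extreme, so no longer route can share it, and all lengths agree. This replaces
  transitivity of \<open>below\<close> inside cliques.\<close>

lemma below_cycle_imp_eq:
  assumes "P \<in> routes s" "Q \<in> routes s" "R \<in> routes s" "below P R" "below R Q" "below Q P"
  shows "P = Q"
proof -
  let ?m = "min (length P) (min (length Q) (length R))"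
  have eq: "lab P i = lab R i" "lab Q i = lab R i" if "1 \<le> i" "i \<le> ?m" for i
  proof -
    have "lab P i \<le> lab R i" "lab R i \<le> lab Q i" "lab Q i \<le> lab P i"
      using assms(4-6) that by (auto simp: below_def)
    then show "lab P i = lab R i" "lab Q i = lab R i" by auto
  qed
  have *: "length X \<le> length Y" if "X \<in> {P, Q, R}" "Y \<in> {P, Q, R}" "length Y = ?m" for X Y
  proof (rule ccontr)
    assume "\<not> length X \<le> length Y"
    moreover have "lab X (length Y) = lab Y (length Y)"
      using eq[of "length Y"] that assms(1-3) route_length[of Y] by auto
    moreover have X: "X \<in> routes s" and Y: "Y \<in> routes s"
      using that assms by auto
    ultimately show False
      using route_inner[OF X, of "length Y"] route_top[OF Y] route_length[OF Y] by auto
  qed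
  have "\<exists>Y\<in>{P, Q, R}. length Y = ?m"
    by (auto simp: min_def)
  then obtain Y where Y: "Y \<in> {P, Q, R}" "length Y = ?m" by blast
  show ?thesis
  proof (rule route_eqI[OF assms(1,2)])
    fix i assume "1 \<le> i" "i \<le> length P" "i \<le> length Q"
    then show "lab P i = lab Q i"
      using eq[of i] *[of P Y] Y by auto
  qed
qed

end

section \<open>Faces and cliques\<close>

lemma nth_occurrence:
  assumes "0 < j" "j \<le> cnt w l c" "l \<le> length w"
  shows "\<exists>p. 0 < p \<and> p \<le> l \<and> w ! (p - 1) = c \<and> cnt w p c = j"
proof -
  define p where "p = (LEAST p. j \<le> cnt w p c)"
  have p: "j \<le> cnt w p c" "p \<le> l"
    unfolding p_def using assms(2) by (auto intro: LeastI Least_le)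
  then obtain q where q: "p = Suc q"
    using assms(1) by (cases p) auto
  have "\<not> j \<le> cnt w q c"
    using not_less_Least[of q "\<lambda>p. j \<le> cnt w p c"] q by (simp add: p_def)
  then show ?thesis
    using p q assms(3) cnt_Suc[of q w c] by (intro exI[of _ p]) (auto split: if_splits)
qed

lemma cnt_pred:
  "0 < p \<Longrightarrow> p \<le> length w \<Longrightarrow> cnt w p c = cnt w (p - 1) c + (if w ! (p - 1) = c then 1 else 0)"
  using cnt_Suc[of "p - 1" w c] by simp

lemma below_refl: "below P P"
  by (simp add: below_def)

section \<open>The maximal clique of a word\<close>

context composition
begin

lemma clique_iff:
  "clique s K \<longleftrightarrow> K \<subseteq> routes s \<and> (\<forall>P\<in>K. \<forall>Q\<in>K. below P Q \<or> below Q P)"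
proof -
  have "pairwise (coherent_routes s) K \<longleftrightarrow> (\<forall>P\<in>K. \<forall>Q\<in>K. below P Q \<or> below Q P)"
    if "K \<subseteq> routes s"
    unfolding pairwise_def
  proof (intro ball_cong refl)
    fix P Q assume "P \<in> K" "Q \<in> K"
    then show "(P \<noteq> Q \<longrightarrow> coherent_routes s P Q) \<longleftrightarrow> below P Q \<or> below Q P"
      using that coherent_iff_below[of P Q] below_refl by (cases "P = Q") auto
  qed
  then show ?thesis unfolding clique_def by blast
qed

text \<open>The entry at \<open>n + 1\<close> is the lower index of the only source-edge with upper index \<open>n + 1\<close>.\<close>

definition prefix_label :: "nat list \<Rightarrow> nat \<Rightarrow> nat \<Rightarrow> nat" where
  "prefix_label w p i = (if i = Suc n then 1 else cnt w p i)"

text \<open>For a Stirling permutation \<open>w\<close> this relation is a function of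
  \<open>p\<close>, by \<open>agrees_exists\<close> and \<open>agrees_unique\<close>, and it is
  injective on prefixes by \<open>agrees_inj\<close>.\<close>

definition agrees :: "nat list \<Rightarrow> nat \<Rightarrow> edge list \<Rightarrow> bool" where
  "agrees w p P \<longleftrightarrow>
     P \<in> routes s \<and> (\<forall>i. 1 \<le> i \<and> i \<le> length P \<longrightarrow> lab P i = prefix_label w p i)"

definition word_routes :: "nat list \<Rightarrow> edge list set" where
  "word_routes w = {P. \<exists>p\<le>length w. agrees w p P}"

lemma agrees_lab: "agrees w p P \<Longrightarrow> 1 \<le> i \<Longrightarrow> i \<le> length P \<Longrightarrow> i \<le> n \<Longrightarrow> lab P i = cnt w p i"
  by (simp add: agrees_def prefix_label_def)

lemma agrees_route: "agrees w p P \<Longrightarrow> P \<in> routes s"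
  by (simp add: agrees_def)

lemma agrees_unique: "agrees w p P \<Longrightarrow> agrees w p Q \<Longrightarrow> P = Q"
  by (rule route_eqI) (auto simp: agrees_def)

lemma agrees_below:
  assumes "agrees w p P" "agrees w q Q" "p \<le> q"
  shows "below P Q"
  using assms cnt_mono[OF assms(3)] by (auto simp: below_def agrees_def prefix_label_def)

lemma word_routes_chain: "P \<in> word_routes w \<Longrightarrow> Q \<in> word_routes w \<Longrightarrow> below P Q \<or> below Q P"
proof -
  assume "P \<in> word_routes w" "Q \<in> word_routes w"
  then obtain p q where "agrees w p P" "agrees w q Q" by (auto simp: word_routes_def)
  then show ?thesis using agrees_below[of w p P q Q] agrees_below[of w q Q p P] by linarith
qed

context
  fixes w
  assumes w: "stirling s w"
begin

lemma stirling_from_w: "stirling_from 1 w"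
  using w by (simp add: stirling_iff)

lemma letter: "p < length w \<Longrightarrow> 1 \<le> w ! p \<and> w ! p \<le> n"
proof -
  assume "p < length w"
  then have "w ! p \<in> set w" by simp
  moreover have "set w \<subseteq> {1..n}" using stirling_from_w by (simp add: stirling_from_def)
  ultimately have "w ! p \<in> {1..n}" by blast
  then show ?thesis by simp
qed

lemma cnt_part: "1 \<le> c \<Longrightarrow> c \<le> n \<Longrightarrow> cnt w p c \<le> part s c"
  using cnt_le_part[OF stirling_from_w] by simp

lemma cnt_full: "1 \<le> c \<Longrightarrow> c \<le> n \<Longrightarrow> cnt w (length w) c = part s c"
  using stirling_from_w by (simp add: stirling_from_def)

lemma cnt_inv: "1 \<le> b \<Longrightarrow> b < c \<Longrightarrow> c \<le> n \<Longrightarrow> cnt w p b < part s b \<Longrightarrow> cnt w p c \<le> inv_num w c b"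
  using cnt_le_inv[OF stirling_from_w] by simp

lemma agrees_exists: "\<exists>P. agrees w p P"
proof -
  define k where "k = (LEAST k. 1 \<le> k \<and> 0 < prefix_label w p k \<and> prefix_label w p k < part s k)"
  \<comment> \<open>The sentinel \<open>Suc n\<close> guarantees an open letter: its label
    \<open>1\<close> lies strictly between \<open>0\<close> and \<open>2\<close>.\<close>
  have top: "1 \<le> Suc n \<and> 0 < prefix_label w p (Suc n) \<and> prefix_label w p (Suc n) < part s (Suc n)"
    by (simp add: prefix_label_def)
  have k: "1 \<le> k" "0 < prefix_label w p k" "prefix_label w p k < part s k" "k \<le> Suc n"
    using LeastI[of "\<lambda>k. 1 \<le> k \<and> 0 < prefix_label w p k \<and> prefix_label w p k < part s k", OF top]
      Least_le[of "\<lambda>k. 1 \<le> k \<and> 0 < prefix_label w p k \<and> prefix_label w p k < part s k", OF top]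
    unfolding k_def by blast+
  have "prefix_label w p i = 0 \<or> prefix_label w p i = part s i" if "1 \<le> i" "i < k" for i
  proof -
    have "\<not> (0 < prefix_label w p i \<and> prefix_label w p i < part s i)"
      using not_less_Least[of i "\<lambda>k. 1 \<le> k \<and> 0 < prefix_label w p k \<and> prefix_label w p k < part s k"] that
      unfolding k_def by blast
    moreover have "prefix_label w p i \<le> part s i"
      using cnt_part[of i p] that k(4) by (simp add: prefix_label_def)
    ultimately show ?thesis by auto
  qed
  then obtain P where "P \<in> routes s" "length P = k" "\<forall>i. 1 \<le> i \<and> i \<le> k \<longrightarrow> lab P i = prefix_label w p i"
    using route_exists[of k "prefix_label w p"] k by blast
  then show ?thesis
    by (auto simp: agrees_def)
qed

text \<open>The letter read at \<open>p\<close> changes its own count, so it must lie above the top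
  \<open>k\<close> of \<open>P\<close>. But \<open>k\<close> is open at both \<open>p\<close> and
  \<open>q\<close>, and no larger letter can be read inside the \<open>k\<close>-block.\<close>

lemma agrees_less_False:
  assumes "p < q" "q \<le> length w" "agrees w p P" "agrees w q P"
  shows False
proof -
  let ?c = "w ! p" and ?k = "length P"
  have c: "1 \<le> ?c" "?c \<le> n" using letter[of p] assms by auto
  have gt: "cnt w p ?c < cnt w q ?c"
    using cnt_Suc[of p w ?c] cnt_mono[of "Suc p" q w ?c] assms by simp
  have k: "?k < ?c"
    using gt agrees_lab[OF assms(3) c(1) _ c(2)] agrees_lab[OF assms(4) c(1) _ c(2)] by force
  have P: "1 \<le> ?k" "0 < lab P ?k" "lab P ?k < part s ?k"
    using route_length route_top agrees_route[OF assms(3)] by auto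
  then have "cnt w p ?k = lab P ?k" "cnt w q ?k = lab P ?k"
    using agrees_lab[OF assms(3)] agrees_lab[OF assms(4)] k c by auto
  then show False
    using gt P inv_num_le_cnt[of p w ?k ?c] cnt_inv[of ?k ?c q] k c by auto
qed

lemma agrees_inj: "p \<le> length w \<Longrightarrow> q \<le> length w \<Longrightarrow> agrees w p P \<Longrightarrow> agrees w q P \<Longrightarrow> p = q"
  using agrees_less_False[of p q P] agrees_less_False[of q p P] by (cases p q rule: linorder_cases) auto

text \<open>A smaller letter that is open here would enclose the larger letter \<open>w ! p\<close>,
  a forbidden pattern.\<close>

lemma closed_before_letter:
  assumes "p < length w" "1 \<le> i" "i < w ! p"
  shows "cnt w p i = 0 \<or> cnt w p i = part s i"
proof (rule ccontr)
  assume "\<not> ?thesis"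
  moreover have c: "w ! p \<le> n" using letter assms by simp
  ultimately have i: "0 < cnt w p i" "cnt w (Suc p) i < part s i"
    using cnt_part[of i p] assms cnt_Suc[of p w i] by auto
  then show False
    using inv_num_le_cnt[OF i(1), of "w ! p"] cnt_inv[OF assms(2,3) c i(2)] cnt_Suc[OF assms(1), of "w ! p"]
    by simp
qed

lemma closed_after_letter:
  assumes "0 < p" "p \<le> length w" "1 \<le> i" "i < w ! (p - 1)"
  shows "cnt w p i = 0 \<or> cnt w p i = part s i"
proof -
  have "p - 1 < length w" "cnt w p i = cnt w (p - 1) i"
    using cnt_pred[of p w i] assms by simp_all
  then show ?thesis using closed_before_letter[of "p - 1" i] assms(3,4) by simp
qed

text \<open>Truncation happens at an open letter, and no letter below \<open>w ! p\<close> is open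
  at \<open>p\<close>.\<close>

lemma agrees_length_ge_next:
  assumes "agrees w p P" "p < length w"
  shows "w ! p \<le> length P"
proof (rule ccontr)
  assume "\<not> ?thesis"
  moreover have "1 \<le> length P" "0 < lab P (length P)" "lab P (length P) < part s (length P)"
    using route_length route_top agrees_route[OF assms(1)] by auto
  ultimately show False
    using closed_before_letter[OF assms(2), of "length P"] letter[OF assms(2)]
      agrees_lab[OF assms(1), of "length P"] by auto
qed

lemma agrees_length_ge_last:
  assumes "agrees w p P" "0 < p" "p \<le> length w"
  shows "w ! (p - 1) \<le> length P"
proof (rule ccontr)
  have last: "p - 1 < length w" using assms by simp
  assume "\<not> ?thesis"
  moreover have "1 \<le> length P" "0 < lab P (length P)" "lab P (length P) < part s (length P)"
    using route_length route_top agrees_route[OF assms(1)] by auto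
  ultimately show False
    using closed_after_letter[OF assms(2,3), of "length P"] letter[OF last]
      agrees_lab[OF assms(1), of "length P"] by auto
qed

text \<open>Membership of a route in the clique of a word amounts to bounds on single inversion numbers.\<close>

lemma word_routes_iff:
  assumes P: "P \<in> routes s"
  shows "P \<in> word_routes w \<longleftrightarrow> (\<forall>a c. 1 \<le> a \<and> a < c \<and> c \<le> length P \<and> c \<le> n \<longrightarrow>
    (lab P a = 0 \<longrightarrow> lab P c \<le> inv_num w c a) \<and> (lab P a = part s a \<longrightarrow> inv_num w c a \<le> lab P c))"
    (is "_ \<longleftrightarrow> ?R")
proof
  assume "P \<in> word_routes w"
  then obtain p where p: "agrees w p P" by (auto simp: word_routes_def)
  show ?R
  proof (intro allI impI, elim conjE)
    fix a c assume ac: "1 \<le> a" "a < c" "c \<le> length P" "c \<le> n"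
    have "lab P a = cnt w p a" "lab P c = cnt w p c"
      using agrees_lab[OF p] ac by auto
    moreover have "0 < part s a" using part_pos ac by auto
    ultimately show "(lab P a = 0 \<longrightarrow> lab P c \<le> inv_num w c a) \<and> (lab P a = part s a \<longrightarrow> inv_num w c a \<le> lab P c)"
      using cnt_inv[OF ac(1,2,4), of p] inv_num_le_cnt[of p w a c] by auto
  qed
next
  assume R: ?R
  \<comment> \<open>The smaller letter of a pair lies below the top of \<open>P\<close>, so its
    label is \<open>0\<close> or full; the hypotheses \<open>0 < r b\<close> and
    \<open>r b < part s b\<close> thereby turn into the two cases of the given condition.\<close>
  have "\<exists>p\<le>length w. \<forall>c\<in>{1..min (length P) n}. cnt w p c = lab P c"
  proof (rule prefix_with_counts[OF stirling_from_w])
    fix c assume "c \<in> {1..min (length P) n}"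
    then show "lab P c \<le> part s c" using lab_le_part[OF P] by auto
  next
    fix b c assume "b \<in> {1..min (length P) n}" "c \<in> {1..min (length P) n}" "b < c" "0 < lab P b"
    then show "inv_num w c b \<le> lab P c" using R route_inner[OF P, of b] by auto
  next
    fix b c assume "b \<in> {1..min (length P) n}" "c \<in> {1..min (length P) n}" "b < c" "lab P b < part s b"
    then show "lab P c \<le> inv_num w c b" using R route_inner[OF P, of b] by auto
  qed auto
  then obtain p where p: "p \<le> length w" "\<And>c. 1 \<le> c \<Longrightarrow> c \<le> length P \<Longrightarrow> c \<le> n \<Longrightarrow> cnt w p c = lab P c"
    by auto
  have "lab P i = prefix_label w p i" if "1 \<le> i" "i \<le> length P" for i
  proof (cases "i = Suc n")
    case True
    then have "length P = Suc n" using that route_length[OF P] by simp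
    then show ?thesis using route_top[OF P] True by (simp add: prefix_label_def)
  next
    case False
    then show ?thesis using p(2)[of i] that route_length[OF P] by (simp add: prefix_label_def)
  qed
  then show "P \<in> word_routes w"
    using p(1) P by (auto simp: word_routes_def agrees_def)
qed

lemma ascent_full:
  assumes "0 < p" "p < length w" "w ! (p - 1) < w ! p"
  shows "cnt w p (w ! (p - 1)) = part s (w ! (p - 1))"
proof -
  have "p - 1 < length w" "0 < cnt w p (w ! (p - 1))"
    using cnt_pred[of p w "w ! (p - 1)"] assms by simp_all
  then show ?thesis
    using closed_before_letter[OF assms(2) _ assms(3)] letter[of "p - 1"] by simp
qed

text \<open>By \<open>ascent_full\<close> an ascent comes right after the last copy of its smaller
  letter.\<close>

lemma ascent_position_unique:
  assumes "0 < p" "p < length w" "w ! (p - 1) < w ! p"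
    and "0 < q" "q < length w" "w ! (q - 1) = w ! (p - 1)" "w ! q = w ! p"
  shows "p = q"
proof -
  have *: False if "x < y" "0 < x" "y < length w" "w ! (y - 1) = w ! (x - 1)" "w ! (x - 1) < w ! x" for x y
  proof -
    have "cnt w y (w ! (x - 1)) = cnt w (y - 1) (w ! (x - 1)) + 1"
      using cnt_pred[of y w "w ! (x - 1)"] that by simp
    moreover have "cnt w x (w ! (x - 1)) \<le> cnt w (y - 1) (w ! (x - 1))"
      using that by (intro cnt_mono) simp
    moreover have "cnt w y (w ! (x - 1)) \<le> part s (w ! (x - 1))"
      using letter[of "x - 1"] that by (intro cnt_part) auto
    ultimately show False using ascent_full[of x] that by simp
  qed
  show ?thesis
    using *[of p q] *[of q p] assms by (metis linorder_neqE_nat)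
qed

end

section \<open>The clique of a face and the word \<open>w + A\<close>\<close>

definition ascent_cuts :: "nat list \<Rightarrow> (nat \<times> nat) set \<Rightarrow> nat set" where
  "ascent_cuts w A = {p. 0 < p \<and> p < length w \<and> (w ! (p - 1), w ! p) \<in> A}"

definition face_routes :: "nat list \<Rightarrow> (nat \<times> nat) set \<Rightarrow> edge list set" where
  "face_routes w A = {P. \<exists>p\<le>length w. p \<notin> ascent_cuts w A \<and> agrees w p P}"

text \<open>For the clique of a face \<open>(w, A)\<close> these are the inversion numbers of \<open>w + A\<close>.\<close>

definition hi :: "edge list set \<Rightarrow> nat \<Rightarrow> nat \<Rightarrow> nat" where
  "hi K c a = (LEAST t. \<exists>P\<in>K. c \<le> length P \<and> lab P a = part s a \<and> lab P c = t)"

context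
  fixes w A
  assumes w: "stirling s w" and A: "A \<subseteq> ascents w"
begin

lemma ascent_cut: "p \<in> ascent_cuts w A \<Longrightarrow> 0 < p \<and> p < length w \<and> w ! (p - 1) < w ! p"
  using A by (auto simp: ascent_cuts_def ascents_def)

lemma ascent_cut_exists:
  assumes "(a, c) \<in> A"
  shows "\<exists>p\<in>ascent_cuts w A. w ! (p - 1) = a \<and> w ! p = c"
proof -
  obtain x y where "w = x @ [a, c] @ y"
    using assms A by (auto simp: ascents_def sublist_def)
  then show ?thesis
    using assms by (intro bexI[of _ "Suc (length x)"]) (auto simp: ascent_cuts_def nth_append)
qed

lemma face_routes_subset: "face_routes w A \<subseteq> word_routes w"
  by (auto simp: face_routes_def word_routes_def)

lemma face_routes_routes: "P \<in> face_routes w A \<Longrightarrow> P \<in> routes s"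
  by (auto simp: face_routes_def agrees_def)

text \<open>The empty prefix never ends inside an ascent, so its route belongs to every face of
  \<open>w\<close>. It supplies all bumps, as \<open>full_route\<close> supplies all dips.\<close>

lemma empty_route:
  "\<exists>P\<in>face_routes w A. length P = Suc n \<and> (\<forall>i. 1 \<le> i \<and> i \<le> n \<longrightarrow> lab P i = 0)"
proof -
  obtain P where P: "agrees w 0 P" using agrees_exists[OF w] by blast
  have "\<not> length P \<le> n"
    using route_top[OF agrees_route[OF P]] route_length[OF agrees_route[OF P]] agrees_lab[OF P, of "length P"]
    by auto
  then have "length P = Suc n" using route_length[OF agrees_route[OF P]] by simp
  then show ?thesis
    using P agrees_lab[OF P] by (intro bexI[of _ P]) (auto simp: face_routes_def ascent_cuts_def)
qed

lemma full_route:
  "\<exists>P\<in>face_routes w A. length P = Suc n \<and> (\<forall>i. 1 \<le> i \<and> i \<le> n \<longrightarrow> lab P i = part s i)"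
proof -
  obtain P where P: "agrees w (length w) P" using agrees_exists[OF w] by blast
  have "\<not> length P \<le> n"
    using route_top[OF agrees_route[OF P]] route_length[OF agrees_route[OF P]] agrees_lab[OF P, of "length P"]
      cnt_full[OF w, of "length P"]
    by auto
  then have "length P = Suc n" using route_length[OF agrees_route[OF P]] by simp
  then show ?thesis
    using P agrees_lab[OF P] cnt_full[OF w]
    by (intro bexI[of _ P]) (auto simp: face_routes_def ascent_cuts_def)
qed

text \<open>A prefix that ends inside an ascent of \<open>A\<close> is extended until it does not.
  Only letters above \<open>w ! (p - 1)\<close> are added, so the counts up to that letter stay the
  same.\<close>

lemma run_end:
  assumes "0 < p" "p \<le> length w"
  shows "\<exists>q\<ge>p. q \<le> length w \<and> q \<notin> ascent_cuts w A \<and> (\<forall>i\<le>w ! (p - 1). cnt w q i = cnt w p i) \<and>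
    w ! (p - 1) \<le> w ! (q - 1)"
  using assms
proof (induction "length w - p" arbitrary: p rule: less_induct)
  case less
  show ?case
  proof (cases "p \<in> ascent_cuts w A")
    case False
    then show ?thesis using less.prems by (intro exI[of _ p]) auto
  next
    case True
    then have p: "p < length w" "w ! (p - 1) < w ! p" using ascent_cut by auto
    then obtain q where q: "Suc p \<le> q" "q \<le> length w" "q \<notin> ascent_cuts w A"
      "\<forall>i\<le>w ! p. cnt w q i = cnt w (Suc p) i" "w ! p \<le> w ! (q - 1)"
      using less.hyps[of "Suc p"] by (auto simp: diff_less_mono2)
    have "cnt w q i = cnt w p i" if "i \<le> w ! (p - 1)" for i
      using q(4) that p cnt_Suc[of p w i] by auto
    then show ?thesis
      using q p by (intro exI[of _ q]) auto
  qed
qed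

text \<open>Take the prefix that ends with the last \<open>c\<close> before the
  \<open>a\<close>-block; \<open>run_end\<close> moves it off the omitted cuts without touching the
  counts of \<open>a\<close> and \<open>c\<close>.\<close>

lemma face_lower:
  assumes "1 \<le> a" "a < c" "c \<le> n" "0 < inv_num w c a"
  shows "\<exists>P\<in>face_routes w A. c \<le> length P \<and> lab P a = 0 \<and> lab P c = inv_num w c a"
proof -
  define l where "l = length (takeWhile ((\<noteq>) a) w)"
  have l: "l \<le> length w" "take l w = takeWhile ((\<noteq>) a) w"
    by (auto simp: l_def length_takeWhile_le takeWhile_eq_take[symmetric])
  have a0: "cnt w l a = 0"
    unfolding l(2) count_list_0_iff by (auto dest: set_takeWhileD)
  have "inv_num w c a \<le> cnt w l c" by (simp add: inv_num_def l)
  then obtain p where p: "0 < p" "p \<le> l" "w ! (p - 1) = c" "cnt w p c = inv_num w c a"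
    using nth_occurrence[OF assms(4) _ l(1)] by blast
  then obtain q where q: "p \<le> q" "q \<le> length w" "q \<notin> ascent_cuts w A"
    "\<And>i. i \<le> c \<Longrightarrow> cnt w q i = cnt w p i" "c \<le> w ! (q - 1)"
    using run_end[of p] l by auto
  obtain P where P: "agrees w q P" using agrees_exists[OF w] by blast
  have "c \<le> length P"
    using agrees_length_ge_last[OF w P] p q by auto
  moreover have "cnt w p a = 0"
    using cnt_mono[OF p(2), of w a] a0 by simp
  ultimately show ?thesis
    using P q p assms agrees_lab[OF P] by (intro bexI[of _ P]) (auto simp: face_routes_def)
qed

lemma hi_attained:
  assumes "1 \<le> a" "a < c" "c \<le> n"
  obtains P where "P \<in> face_routes w A" "c \<le> length P" "lab P a = part s a"
    "lab P c = hi (face_routes w A) c a"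
proof -
  have "\<exists>t. \<exists>P\<in>face_routes w A. c \<le> length P \<and> lab P a = part s a \<and> lab P c = t"
    using full_route assms by force
  from LeastI_ex[OF this] show ?thesis
    using that unfolding hi_def by blast
qed

lemma hi_le: "P \<in> K \<Longrightarrow> c \<le> length P \<Longrightarrow> lab P a = part s a \<Longrightarrow> hi K c a \<le> lab P c"
  unfolding hi_def by (rule Least_le) blast

lemma face_crossing:
  assumes "P \<in> face_routes w A" "Q \<in> face_routes w A"
    "1 \<le> a" "a \<le> length P" "a \<le> length Q" "1 \<le> b" "b \<le> length P" "b \<le> length Q"
    "lab P a < lab Q a"
  shows "lab P b \<le> lab Q b"
proof -
  have "below P Q \<or> below Q P"
    using word_routes_chain[of P w Q] face_routes_subset assms(1,2) by blast
  moreover have "\<not> below Q P" using assms(3-5,9) by (auto simp: below_def not_le)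
  ultimately show ?thesis using assms(6-8) by (auto simp: below_def)
qed

text \<open>Transitivity: the route attaining \<open>hi\<close> at \<open>(c, a)\<close> has a
  positive, hence full, label at \<open>b\<close>, so it also competes for \<open>(c, b)\<close>.
  Planarity: the route attaining \<open>hi\<close> at \<open>(c, b)\<close> cannot have label
  \<open>0\<close> at \<open>a\<close>, since it would cross the route attaining \<open>hi\<close>
  at \<open>(b, a)\<close>; so it competes for \<open>(c, a)\<close>.\<close>

lemma exists_word_hi:
  "\<exists>u. stirling s u \<and> (\<forall>a c. 1 \<le> a \<longrightarrow> a < c \<longrightarrow> c \<le> n \<longrightarrow> inv_num u c a = hi (face_routes w A) c a)"
  unfolding stirling_iff
proof (rule exists_stirling_from)
  fix a c assume ac: "1 \<le> a" "a < c" "c \<le> n"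
  obtain P where P: "P \<in> face_routes w A" "c \<le> length P" "lab P c = hi (face_routes w A) c a"
    using hi_attained[OF ac] by blast
  then show "hi (face_routes w A) c a \<le> part s c"
    using lab_le_part[OF face_routes_routes[OF P(1)], of c] ac by simp
next
  fix a b c
  assume abc: "1 \<le> a" "a < b" "b < c" "c \<le> n" and pos: "0 < hi (face_routes w A) b a"
  obtain P where P: "P \<in> face_routes w A" "c \<le> length P" "lab P a = part s a" "lab P c = hi (face_routes w A) c a"
    using hi_attained[of a c] abc by auto
  then have "0 < lab P b"
    using pos hi_le[of P "face_routes w A" b a] abc by auto
  then have "lab P b = part s b"
    using route_inner[OF face_routes_routes[OF P(1)], of b] abc P by auto
  then show "hi (face_routes w A) c b \<le> hi (face_routes w A) c a"
    using P hi_le[of P "face_routes w A" c b] by simp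
next
  fix a b c
  assume abc: "1 \<le> a" "a < b" "b < c" "c \<le> n" and lt: "hi (face_routes w A) b a < part s b"
  obtain P where P: "P \<in> face_routes w A" "c \<le> length P" "lab P b = part s b" "lab P c = hi (face_routes w A) c b"
    using hi_attained[of b c] abc by auto
  obtain Q where Q: "Q \<in> face_routes w A" "b \<le> length Q" "lab Q a = part s a" "lab Q b = hi (face_routes w A) b a"
    using hi_attained[of a b] abc by auto
  have "lab P a \<noteq> 0"
  proof
    assume "lab P a = 0"
    then have "lab P a < lab Q a" using Q part_pos[of a] abc by simp
    then have "lab P b \<le> lab Q b"
      using face_crossing[OF P(1) Q(1), of a b] abc P Q by auto
    then show False using lt P Q by simp
  qed
  then have "lab P a = part s a"
    using route_inner[OF face_routes_routes[OF P(1)], of a] abc P by auto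
  then show "hi (face_routes w A) c a \<le> hi (face_routes w A) c b"
    using P hi_le[of P "face_routes w A" c a] by simp
qed auto

text \<open>A prefix with all copies of \<open>a\<close> contains everything before the
  \<open>a\<close>-block. If \<open>(a, c)\<close> is in \<open>A\<close>, it may not stop right
  after the last \<open>a\<close>, so it also contains the \<open>c\<close> that follows.\<close>

lemma inv_num_le_hi:
  assumes "1 \<le> a" "a < c" "c \<le> n"
  shows "inv_num w c a + (if (a, c) \<in> A then 1 else 0) \<le> hi (face_routes w A) c a"
proof -
  obtain P where P: "P \<in> face_routes w A" "c \<le> length P" "lab P a = part s a" "lab P c = hi (face_routes w A) c a"
    using hi_attained[OF assms] by blast
  then obtain q where q: "q \<le> length w" "q \<notin> ascent_cuts w A" "agrees w q P"
    by (auto simp: face_routes_def)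
  have cq: "cnt w q a = part s a" "cnt w q c = hi (face_routes w A) c a"
    using agrees_lab[OF q(3)] P assms by auto
  have le: "inv_num w c a \<le> cnt w q c"
    using cq part_pos[of a] assms by (intro inv_num_le_cnt) auto
  show ?thesis
  proof (cases "(a, c) \<in> A")
    case False
    then show ?thesis using le cq by simp
  next
    case True
    then obtain p where p: "p \<in> ascent_cuts w A" "w ! (p - 1) = a" "w ! p = c"
      using ascent_cut_exists by blast
    have p': "0 < p" "p < length w" using ascent_cut[OF p(1)] by auto
    have ca: "cnt w p a = part s a"
      using ascent_full[OF w p'] ascent_cut[OF p(1)] p by simp
    have "\<not> q \<le> p - 1"
    proof
      assume "q \<le> p - 1"
      then have "cnt w q a \<le> cnt w (p - 1) a" by (rule cnt_mono)
      moreover have "cnt w p a = Suc (cnt w (p - 1) a)"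
        using cnt_pred[of p w a] p p' by simp
      ultimately show False using ca cq by linarith
    qed
    moreover have "q \<noteq> p" using q p by auto
    ultimately have "Suc p \<le> q" by simp
    then have "cnt w (Suc p) c \<le> cnt w q c" by (rule cnt_mono)
    moreover have "inv_num w c a \<le> cnt w p c"
      using ca part_pos[of a] assms by (intro inv_num_le_cnt) auto
    ultimately show ?thesis
      using True cq cnt_Suc[of p w c] p p' by simp
  qed
qed

text \<open>
  Starting after the last \<open>a\<close>, follow the ascents in \<open>A\<close>: each step \<open>(b, c)\<close> adds one \<open>c\<close>, and
  transitivity of \<open>I\<close> passes the increment of \<open>I c b\<close> on to \<open>I c a\<close>.
\<close>

lemma run_end_bounded:
  assumes I: "above_asc s w A I" "transitive_inv s I" and a: "1 \<le> a" "a \<le> n"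
    and "0 < x" "x \<le> length w" "cnt w x a = part s a" "a \<le> w ! (x - 1)"
    "w ! (x - 1) = a \<or> 0 < I (w ! (x - 1)) a" "\<forall>c. a < c \<and> c \<le> n \<longrightarrow> cnt w x c \<le> I c a"
  shows "\<exists>q. 0 < q \<and> q \<le> length w \<and> q \<notin> ascent_cuts w A \<and> cnt w q a = part s a \<and>
    a \<le> w ! (q - 1) \<and> (\<forall>c. a < c \<and> c \<le> n \<longrightarrow> cnt w q c \<le> I c a)"
  using assms(5-)
proof (induction "length w - x" arbitrary: x rule: less_induct)
  case less
  show ?case
  proof (cases "x \<in> ascent_cuts w A")
    case False
    then show ?thesis using less.prems by (intro exI[of _ x]) auto
  next
    case True
    let ?b = "w ! (x - 1)" and ?c = "w ! x"
    have x: "x < length w" "?b < ?c" "(?b, ?c) \<in> A" using ascent_cut[OF True] True by (auto simp: ascent_cuts_def)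
    have bc: "1 \<le> ?b" "?c \<le> n" "a < ?c"
      using letter[OF w, of "x - 1"] letter[OF w, of x] x less.prems by auto
    have "cnt w x ?b = part s ?b"
      using ascent_full[OF w less.prems(1) x(1,2)] .
    moreover have "cnt w x i = cnt w (x - 1) i + (if ?b = i then 1 else 0)" for i
      using cnt_pred[of x w i] less.prems x by simp
    \<comment> \<open>At \<open>x - 1\<close> the last \<open>?b\<close> is still missing, so
      \<open>cnt_inv\<close> applies there, and reading \<open>?b\<close> leaves the count of
      \<open>?c\<close> unchanged.\<close>
    ultimately have "cnt w x ?c \<le> inv_num w ?c ?b"
      using cnt_inv[OF w bc(1) x(2) bc(2), of "x - 1"] x(2) by simp
    then have le: "Suc (cnt w x ?c) \<le> I ?c ?b"
      using I(1) x bc unfolding above_asc_def by fastforce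
    have "I ?c ?b \<le> I ?c a"
    proof (cases "?b = a")
      case False
      then have "a < ?b" "I ?b a \<noteq> 0" using less.prems by auto
      then show ?thesis
        using I(2)[unfolded transitive_inv_def, rule_format, of a ?b ?c] a(1) x(2) bc(2) by simp
    qed simp
    then have ge: "Suc (cnt w x ?c) \<le> I ?c a" using le by simp
    have "cnt w (Suc x) c \<le> I c a" if "a < c" "c \<le> n" for c
      using that ge less.prems x cnt_Suc[of x w c] by auto
    moreover have "cnt w (Suc x) a = part s a"
      using cnt_Suc[OF x(1), of a] less.prems bc by simp
    ultimately show ?thesis
      using less.hyps[of "Suc x"] x bc ge by auto
  qed
qed

text \<open>The prefix from \<open>run_end_bounded\<close> proves the bound if its route reaches
  \<open>c\<close>. Otherwise the route stops at an open letter \<open>?b\<close> between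
  \<open>a\<close> and \<open>c\<close>: the induction treats \<open>(c, ?b)\<close>, transitivity
  passes from \<open>I c ?b\<close> to \<open>I c a\<close>, and non-crossing gives the matching
  inequality for \<open>hi\<close>.\<close>

lemma hi_least:
  assumes I: "above_asc s w A I" "transitive_inv s I" and "1 \<le> a" "a < c" "c \<le> n"
  shows "hi (face_routes w A) c a \<le> I c a"
  using assms(3-)
proof (induction "c - a" arbitrary: a rule: less_induct)
  case less
  then have a: "1 \<le> a" "a \<le> n" by auto
  obtain x where x: "0 < x" "x \<le> length w" "w ! (x - 1) = a" "cnt w x a = part s a"
    using nth_occurrence[of "part s a" "length w" w a] part_pos[of a] cnt_full[OF w a] a by auto
  have step: "cnt w x i = cnt w (x - 1) i + (if a = i then 1 else 0)" for i
    using cnt_pred[of x w i] x by simp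
  have "cnt w x c' \<le> I c' a" if "a < c'" "c' \<le> n" for c'
  proof -
    have "cnt w x c' \<le> inv_num w c' a"
      using step[of a] step[of c'] that x cnt_inv[OF w a(1) that, of "x - 1"] by simp
    also have "\<dots> \<le> I c' a"
      using I(1) a that unfolding above_asc_def by (meson add_leD1)
    finally show ?thesis .
  qed
  then obtain q where q: "0 < q" "q \<le> length w" "q \<notin> ascent_cuts w A" "cnt w q a = part s a"
    "a \<le> w ! (q - 1)" "\<And>c. a < c \<Longrightarrow> c \<le> n \<Longrightarrow> cnt w q c \<le> I c a"
    using run_end_bounded[OF I a x(1,2,4)] x(3) by auto
  obtain P where P: "agrees w q P" using agrees_exists[OF w] by blast
  have PK: "P \<in> face_routes w A" using P q by (auto simp: face_routes_def)
  have lab: "\<And>i. 1 \<le> i \<Longrightarrow> i \<le> length P \<Longrightarrow> i \<le> n \<Longrightarrow> lab P i = cnt w q i"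
    using agrees_lab[OF P] .
  show ?case
  proof (cases "c \<le> length P")
    case True
    then have "hi (face_routes w A) c a \<le> lab P c"
      using PK lab q(4) less.prems by (intro hi_le) auto
    also have "\<dots> \<le> I c a" using lab q(6) True less.prems by auto
    finally show ?thesis .
  next
    case False
    let ?b = "length P"
    have top: "1 \<le> ?b" "0 < lab P ?b" "lab P ?b < part s ?b"
      using route_length route_top agrees_route[OF P] by auto
    have "a \<le> ?b" using agrees_length_ge_last[OF w P q(1,2)] q(5) by simp
    moreover have b: "lab P ?b = cnt w q ?b" using lab[of ?b] top False less.prems by simp
    ultimately have ab: "a < ?b" using q(4) top by (cases "a = ?b") auto
    have "0 < I ?b a" using q(6)[of ?b] ab b top False less.prems by simp
    then have "I c ?b \<le> I c a"
      using I(2) a ab False less.prems unfolding transitive_inv_def by (metis not_gr_zero not_le)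
    moreover have "hi (face_routes w A) c ?b \<le> I c ?b"
      using less.hyps[of ?b] ab False less.prems by simp
    moreover have "hi (face_routes w A) c a \<le> hi (face_routes w A) c ?b"
    proof -
      obtain Q where Q: "Q \<in> face_routes w A" "c \<le> length Q" "lab Q ?b = part s ?b"
        "lab Q c = hi (face_routes w A) c ?b"
        using hi_attained[of ?b c] top False less.prems by auto
      have "lab P a \<le> lab Q a"
        using face_crossing[OF PK Q(1), of ?b a] top a ab Q False by auto
      then have "lab Q a = part s a"
        using lab[of a] q(4) a ab lab_le_part[OF face_routes_routes[OF Q(1)], of a] Q False less.prems by auto
      then show ?thesis using hi_le[OF Q(1,2)] Q(4) by simp
    qed
    ultimately show ?thesis by simp
  qed
qed

text \<open>The word realising \<open>hi\<close> meets the specification under \<open>THE\<close>;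
  two words that meet it bound each other's inversion numbers, so they coincide.\<close>

lemma plus_asc:
  "stirling s (plus_asc s w A)"
  "1 \<le> a \<Longrightarrow> a < c \<Longrightarrow> c \<le> n \<Longrightarrow> inv_num (plus_asc s w A) c a = hi (face_routes w A) c a"
proof -
  obtain u where u: "stirling s u"
    and inv: "\<And>a c. 1 \<le> a \<Longrightarrow> a < c \<Longrightarrow> c \<le> n \<Longrightarrow> inv_num u c a = hi (face_routes w A) c a"
    using exists_word_hi by blast
  have above: "above_asc s w A (inv_num u)"
    using inv_num_le_hi inv by (auto simp: above_asc_def)
  have trans: "transitive_inv s (inv_num v)" if "stirling s v" for v
    unfolding transitive_inv_def
  proof (intro allI impI)
    fix a b c assume abc: "1 \<le> a \<and> a < b \<and> b < c \<and> c \<le> n"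
    define l where "l = length (takeWhile ((\<noteq>) a) v)"
    have l: "take l v = takeWhile ((\<noteq>) a) v"
      by (auto simp: l_def takeWhile_eq_take[symmetric])
    then show "inv_num v b a = 0 \<or> inv_num v c b \<le> inv_num v c a"
      using inv_num_le_cnt[of l v b c] by (auto simp: inv_num_def)
  qed
  have "plus_asc s w A = u"
    unfolding plus_asc_def
  proof (rule the_equality)
    show "stirling s u \<and> above_asc s w A (inv_num u) \<and> transitive_inv s (inv_num u) \<and>
      (\<forall>I. above_asc s w A I \<and> transitive_inv s I \<longrightarrow>
        (\<forall>a c. 1 \<le> a \<and> a < c \<and> c \<le> length s \<longrightarrow> inv_num u c a \<le> I c a))"
      using u above trans[OF u] hi_least inv by auto
  next
    fix v
    assume v: "stirling s v \<and> above_asc s w A (inv_num v) \<and> transitive_inv s (inv_num v) \<and>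
      (\<forall>I. above_asc s w A I \<and> transitive_inv s I \<longrightarrow>
        (\<forall>a c. 1 \<le> a \<and> a < c \<and> c \<le> length s \<longrightarrow> inv_num v c a \<le> I c a))"
    show "v = u"
    proof (rule stirling_eqI)
      fix a c assume ac: "1 \<le> a" "a < c" "c \<le> n"
      have "inv_num v c a \<le> inv_num u c a" using v above trans[OF u] ac by blast
      moreover have "inv_num u c a \<le> inv_num v c a" using v hi_least[of "inv_num v"] ac inv by simp
      ultimately show "inv_num v c a = inv_num u c a" by simp
    qed (use v u in auto)
  qed
  then show "stirling s (plus_asc s w A)"
    "1 \<le> a \<Longrightarrow> a < c \<Longrightarrow> c \<le> n \<Longrightarrow> inv_num (plus_asc s w A) c a = hi (face_routes w A) c a"
    using u inv by auto
qed

text \<open>By \<open>word_routes_iff\<close> each route bounds inversion numbers from below at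
  labels \<open>0\<close> and from above at full labels. Over the whole face the sharpest lower
  bounds are those of \<open>w\<close>, by \<open>face_lower\<close>, and the sharpest upper bounds
  are \<open>hi\<close>, those of \<open>w + A\<close>.\<close>

lemma face_interval:
  "weak_interval s w (plus_asc s w A) = {u. stirling s u \<and> face_routes w A \<subseteq> word_routes u}"
proof (intro equalityI subsetI)
  fix u assume "u \<in> weak_interval s w (plus_asc s w A)"
  then have u: "stirling s u"
    and lower: "\<And>a c. 1 \<le> a \<Longrightarrow> a < c \<Longrightarrow> c \<le> n \<Longrightarrow> inv_num w c a \<le> inv_num u c a"
    and upper: "\<And>a c. 1 \<le> a \<Longrightarrow> a < c \<Longrightarrow> c \<le> n \<Longrightarrow> inv_num u c a \<le> hi (face_routes w A) c a"
    using plus_asc(2) by (force simp: weak_interval_def weak_le_def)+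
  have "P \<in> word_routes u" if P: "P \<in> face_routes w A" for P
  proof -
    note PR = face_routes_routes[OF P]
    have "P \<in> word_routes w" using P face_routes_subset by blast
    note Pw = this[unfolded word_routes_iff[OF w PR], rule_format]
    show ?thesis
      unfolding word_routes_iff[OF u PR]
    proof (intro allI impI conjI; elim conjE)
      fix a c assume ac: "1 \<le> a" "a < c" "c \<le> length P" "c \<le> n"
      {
        assume "lab P a = 0"
        then show "lab P c \<le> inv_num u c a" using Pw[of a c] lower[of a c] ac by auto
      next
        assume "lab P a = part s a"
        then show "inv_num u c a \<le> lab P c" using upper[of a c] hi_le[OF P ac(3)] ac le_trans by blast
      }
    qed
  qed
  then show "u \<in> {u. stirling s u \<and> face_routes w A \<subseteq> word_routes u}" using u by blast
next
  fix u assume "u \<in> {u. stirling s u \<and> face_routes w A \<subseteq> word_routes u}"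
  then have u: "stirling s u" and sub: "face_routes w A \<subseteq> word_routes u" by auto
  have "inv_num w c a \<le> inv_num u c a \<and> inv_num u c a \<le> inv_num (plus_asc s w A) c a"
    if ac: "1 \<le> a" "a < c" "c \<le> n" for a c
  proof
    show "inv_num w c a \<le> inv_num u c a"
    proof (cases "inv_num w c a = 0")
      case False
      then obtain P where P: "P \<in> face_routes w A" "c \<le> length P" "lab P a = 0" "lab P c = inv_num w c a"
        using face_lower[OF ac] by auto
      then have "P \<in> word_routes u" using sub by blast
      then show ?thesis using P ac word_routes_iff[OF u face_routes_routes[OF P(1)]] by metis
    qed simp
    obtain P where P: "P \<in> face_routes w A" "c \<le> length P" "lab P a = part s a"
      "lab P c = hi (face_routes w A) c a"
      using hi_attained[OF ac] by blast
    then have "P \<in> word_routes u" using sub by blast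
    then have "inv_num u c a \<le> lab P c"
      using P ac word_routes_iff[OF u face_routes_routes[OF P(1)]] by metis
    then show "inv_num u c a \<le> inv_num (plus_asc s w A) c a"
      using plus_asc(2)[OF ac] P(4) by simp
  qed
  then show "u \<in> weak_interval s w (plus_asc s w A)"
    using u by (auto simp: weak_interval_def weak_le_def)
qed

lemma mem_face_interval_iff:
  "u \<in> weak_interval s w (plus_asc s w A) \<longleftrightarrow> stirling s u \<and> face_routes w A \<subseteq> word_routes u"
  by (simp add: face_interval)

lemma interval_ends:
  "w \<in> weak_interval s w (plus_asc s w A)" "plus_asc s w A \<in> weak_interval s w (plus_asc s w A)"
proof -
  have "inv_num w c a \<le> inv_num (plus_asc s w A) c a" if "1 \<le> a" "a < c" "c \<le> n" for a c
    using inv_num_le_hi[OF that] plus_asc(2)[OF that] by simp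
  then show "w \<in> weak_interval s w (plus_asc s w A)" "plus_asc s w A \<in> weak_interval s w (plus_asc s w A)"
    using w plus_asc(1) by (simp_all add: weak_interval_def weak_le_def)
qed

text \<open>The route of a prefix that ends inside \<open>(a, c)\<close> in \<open>A\<close> is full
  at \<open>a\<close> but has at most \<open>inv_num w c a\<close> copies of \<open>c\<close>, fewer
  than \<open>w + A\<close> demands.\<close>

lemma face_routes_eq: "face_routes w A = word_routes w \<inter> word_routes (plus_asc s w A)"
proof
  show "face_routes w A \<subseteq> word_routes w \<inter> word_routes (plus_asc s w A)"
    using face_routes_subset interval_ends(2)[unfolded mem_face_interval_iff] by simp
  show "word_routes w \<inter> word_routes (plus_asc s w A) \<subseteq> face_routes w A"
  proof (intro subsetI, elim IntE)
    fix P assume "P \<in> word_routes w" and P': "P \<in> word_routes (plus_asc s w A)"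
    then obtain p where p: "p \<le> length w" "agrees w p P" by (auto simp: word_routes_def)
    note PR = agrees_route[OF p(2)]
    have "p \<notin> ascent_cuts w A"
    proof
      assume cut: "p \<in> ascent_cuts w A"
      let ?a = "w ! (p - 1)" and ?c = "w ! p"
      have c: "0 < p" "p < length w" "?a < ?c" "(?a, ?c) \<in> A"
        using ascent_cut[OF cut] cut by (auto simp: ascent_cuts_def)
      have ac: "1 \<le> ?a" "?a < ?c" "?c \<le> n" "?c \<le> length P"
        using letter[OF w, of "p - 1"] letter[OF w, of p] c agrees_length_ge_next[OF w p(2) c(2)] by auto
      have a: "cnt w p ?a = part s ?a" using ascent_full[OF w c(1-3)] .
      then have "lab P ?a = part s ?a" using agrees_lab[OF p(2), of ?a] ac by simp
      then have "hi (face_routes w A) ?c ?a \<le> lab P ?c"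
        using P' ac plus_asc word_routes_iff[OF plus_asc(1) PR] by metis
      moreover have "lab P ?c = cnt w p ?c" using agrees_lab[OF p(2), of ?c] ac by simp
      moreover have "cnt w p i = cnt w (p - 1) i + (if ?a = i then 1 else 0)" for i
        using cnt_pred[of p w i] c by simp
      then have "cnt w p ?c \<le> inv_num w ?c ?a"
        using cnt_inv[OF w ac(1-3), of "p - 1"] a c by simp
      ultimately show False
        using inv_num_le_hi[OF ac(1-3)] c(4) by simp
    qed
    then show "P \<in> face_routes w A" using p by (auto simp: face_routes_def)
  qed
qed

lemma face_routes_clique: "clique s (face_routes w A)"
  unfolding clique_iff using face_routes_routes face_routes_subset word_routes_chain by blast

text \<open>The source-edge \<open>(k, t)\<close> with \<open>k \<le> n\<close> is used by the
  prefix ending with the \<open>t\<close>-th \<open>k\<close>. Since \<open>t < part s k\<close>,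
  this is not the last \<open>k\<close>, so the prefix does not end inside an ascent.\<close>

lemma face_routes_cover:
  assumes "e \<in> arcs G"
  shows "\<exists>P\<in>face_routes w A. e \<in> set P"
proof -
  obtain E where E: "E \<in> face_routes w A" "length E = Suc n" "\<And>i. 1 \<le> i \<Longrightarrow> i \<le> n \<Longrightarrow> lab E i = 0"
    using empty_route by blast
  obtain F where F: "F \<in> face_routes w A" "length F = Suc n" "\<And>i. 1 \<le> i \<Longrightarrow> i \<le> n \<Longrightarrow> lab F i = part s i"
    using full_route by blast
  obtain k t where e: "e = (k, t)" by fastforce
  from assms show ?thesis
  proof (cases rule: arcs_cases)
    case 1
    then have kt: "1 \<le> k" "k \<le> Suc n" "0 < t" "t < part s k" using e by auto
    show ?thesis
    proof (cases "k = Suc n")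
      case True
      then have "lab E k = t"
        using route_top[OF face_routes_routes[OF E(1)]] E(2) kt by simp
      then show ?thesis
        using E kt True e edge_mem_route_iff[OF face_routes_routes[OF E(1)]] by (intro bexI[of _ E]) auto
    next
      case False
      then have k: "k \<le> n" using kt by simp
      then obtain p where p: "0 < p" "p \<le> length w" "w ! (p - 1) = k" "cnt w p k = t"
        using nth_occurrence[OF kt(3), of "length w" w k] cnt_full[OF w kt(1) k] kt(4) by auto
      have "p \<notin> ascent_cuts w A"
      proof
        assume "p \<in> ascent_cuts w A"
        then show False using ascent_full[OF w, of p] ascent_cut[of p] p kt by auto
      qed
      moreover obtain P where P: "agrees w p P" using agrees_exists[OF w] by blast
      ultimately have PK: "P \<in> face_routes w A" using p by (auto simp: face_routes_def)
      have "k \<le> length P" using agrees_length_ge_last[OF w P p(1,2)] p(3) by simp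
      then have "lab P k = t" using agrees_lab[OF P kt(1) _ k] p by simp
      then show ?thesis
        using PK e kt \<open>k \<le> length P\<close> edge_mem_route_iff[OF face_routes_routes[OF PK]]
        by (intro bexI[of _ P]) auto
    qed
  next
    case 2
    then have kt: "1 \<le> k" "k \<le> n" "t = 0 \<or> t = part s k" using e by auto
    then show ?thesis
      using E F e edge_mem_route_iff[OF face_routes_routes[OF E(1)]] edge_mem_route_iff[OF face_routes_routes[OF F(1)]]
      by (metis le_SucI)
  qed
qed

end

section \<open>The face order as reverse inclusion of cliques\<close>

lemma face_le_iff:
  assumes "(w, A) \<in> perm_faces s" "(w', A') \<in> perm_faces s"
  shows "face_le s (w, A) (w', A') \<longleftrightarrow> face_routes w' A' \<subseteq> face_routes w A"
proof -
  have F: "stirling s w" "A \<subseteq> ascents w" and F': "stirling s w'" "A' \<subseteq> ascents w'"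
    using assms by (auto simp: perm_faces_def)
  show ?thesis
    unfolding face_le_def fst_conv snd_conv
  proof
    \<comment> \<open>Only the two ends of the smaller interval are needed here: their cliques meet
      exactly in \<open>face_routes w A\<close>.\<close>
    assume "weak_interval s w (plus_asc s w A) \<subseteq> weak_interval s w' (plus_asc s w' A')"
    then have "w \<in> weak_interval s w' (plus_asc s w' A')"
      "plus_asc s w A \<in> weak_interval s w' (plus_asc s w' A')"
      using interval_ends[OF F] by auto
    then show "face_routes w' A' \<subseteq> face_routes w A"
      unfolding face_routes_eq[OF F] mem_face_interval_iff[OF F'] by simp
  next
    assume "face_routes w' A' \<subseteq> face_routes w A"
    then show "weak_interval s w (plus_asc s w A) \<subseteq> weak_interval s w' (plus_asc s w' A')"
      unfolding face_interval[OF F'] face_interval[OF F] using subset_trans by fast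
  qed
qed

lemma face_routes_subset_ascents:
  assumes w: "stirling s w" and A: "A \<subseteq> ascents w" and A': "A' \<subseteq> ascents w"
    and eq: "face_routes w A = face_routes w A'"
  shows "A \<subseteq> A'"
proof (intro subsetI, clarify)
  fix a c assume "(a, c) \<in> A"
  then obtain p where p: "p \<in> ascent_cuts w A" "w ! (p - 1) = a" "w ! p = c"
    using ascent_cut_exists[OF w A] by blast
  then have len: "p \<le> length w" by (auto simp: ascent_cuts_def)
  obtain P where P: "agrees w p P" using agrees_exists[OF w] by blast
  have "P \<notin> face_routes w A"
    using p(1) agrees_inj[OF w len _ P] by (auto simp: face_routes_def)
  then have "P \<notin> face_routes w A'" using eq by simp
  then have "p \<in> ascent_cuts w A'" using P len by (auto simp: face_routes_def)
  then show "(a, c) \<in> A'" using p by (simp add: ascent_cuts_def)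
qed

text \<open>Equal cliques give equal intervals, whose least elements \<open>w\<close> and
  \<open>w'\<close> coincide; the omitted prefixes then determine the ascents.\<close>

lemma face_routes_inj:
  assumes "(w, A) \<in> perm_faces s" "(w', A') \<in> perm_faces s" "face_routes w A = face_routes w' A'"
  shows "w = w' \<and> A = A'"
proof -
  have F: "stirling s w" "A \<subseteq> ascents w" and F': "stirling s w'" "A' \<subseteq> ascents w'"
    using assms by (auto simp: perm_faces_def)
  have "weak_interval s w (plus_asc s w A) = weak_interval s w' (plus_asc s w' A')"
    unfolding face_interval[OF F] face_interval[OF F'] assms(3) ..
  then have "weak_le s w w'" "weak_le s w' w"
    using interval_ends[OF F] interval_ends[OF F'] by (auto simp: weak_interval_def)
  then have "w = w'"
    using F F' by (intro stirling_eqI) (auto simp: weak_le_def le_antisym)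
  then show ?thesis
    using face_routes_subset_ascents[of w A A'] face_routes_subset_ascents[of w A' A] F F' assms(3) by blast
qed

section \<open>From covering cliques back to faces\<close>

text \<open>These are the inversion numbers of the least word whose clique contains \<open>K\<close>.\<close>

definition lo :: "edge list set \<Rightarrow> nat \<Rightarrow> nat \<Rightarrow> nat" where
  "lo K c a = (LEAST t. \<forall>P\<in>K. c \<le> length P \<and> lab P a = 0 \<longrightarrow> lab P c \<le> t)"

context
  fixes K
  assumes K: "clique s K"
begin

lemma clique_route: "P \<in> K \<Longrightarrow> P \<in> routes s"
  using K by (auto simp: clique_iff)

lemma clique_crossing:
  assumes "P \<in> K" "Q \<in> K" "1 \<le> a" "a \<le> length P" "a \<le> length Q" "1 \<le> b" "b \<le> length P" "b \<le> length Q"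
    "lab P a < lab Q a"
  shows "lab P b \<le> lab Q b"
proof -
  have "below P Q \<or> below Q P" using K assms(1,2) by (auto simp: clique_iff)
  moreover have "\<not> below Q P" using assms(3-5,9) by (auto simp: below_def not_le)
  ultimately show ?thesis using assms(6-8) by (auto simp: below_def)
qed

lemma lo_bounds:
  assumes "1 \<le> c"
  shows "P \<in> K \<Longrightarrow> c \<le> length P \<Longrightarrow> lab P a = 0 \<Longrightarrow> lab P c \<le> lo K c a" and "lo K c a \<le> part s c"
proof -
  have *: "\<forall>P\<in>K. c \<le> length P \<and> lab P a = 0 \<longrightarrow> lab P c \<le> part s c"
    using clique_route lab_le_part assms by auto
  from LeastI[of "\<lambda>t. \<forall>P\<in>K. c \<le> length P \<and> lab P a = 0 \<longrightarrow> lab P c \<le> t", OF *]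
  show "P \<in> K \<Longrightarrow> c \<le> length P \<Longrightarrow> lab P a = 0 \<Longrightarrow> lab P c \<le> lo K c a"
    unfolding lo_def by blast
  show "lo K c a \<le> part s c"
    unfolding lo_def by (rule Least_le) (rule *)
qed

lemma lo_attained:
  assumes "1 \<le> c" "0 < lo K c a"
  obtains P where "P \<in> K" "c \<le> length P" "lab P a = 0" "lab P c = lo K c a"
proof -
  have "\<not> (\<forall>P\<in>K. c \<le> length P \<and> lab P a = 0 \<longrightarrow> lab P c \<le> lo K c a - 1)"
    using assms(2) unfolding lo_def by (intro not_less_Least) simp
  then obtain P where "P \<in> K" "c \<le> length P" "lab P a = 0" "lo K c a - 1 < lab P c"
    by (auto simp: not_le)
  then show ?thesis
    using lo_bounds(1)[OF assms(1), of P a] that[of P] by simp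
qed

text \<open>Dual to \<open>exists_word_hi\<close>: non-crossing now yields transitivity, and extreme
  inner labels yield planarity. Unlike \<open>hi\<close>, the value \<open>0\<close> of
  \<open>lo\<close> need not be attained by a route, hence the case distinctions.\<close>

lemma exists_word_lo:
  "\<exists>u. stirling s u \<and> (\<forall>a c. 1 \<le> a \<longrightarrow> a < c \<longrightarrow> c \<le> n \<longrightarrow> inv_num u c a = lo K c a)"
  unfolding stirling_iff
proof (rule exists_stirling_from)
  fix a c :: nat assume "1 \<le> a" "a < c"
  then show "lo K c a \<le> part s c" by (intro lo_bounds) simp
next
  fix a b c
  assume abc: "1 \<le> a" "a < b" "b < c" "c \<le> n" and pos: "0 < lo K b a"
  show "lo K c b \<le> lo K c a"
  proof (cases "lo K c b = 0")
    case False
    then obtain P where P: "P \<in> K" "c \<le> length P" "lab P b = 0" "lab P c = lo K c b"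
      using lo_attained[of c b] abc by auto
    obtain Q where Q: "Q \<in> K" "b \<le> length Q" "lab Q a = 0" "lab Q b = lo K b a"
      using lo_attained[of b a] abc pos by auto
    have "lab P a \<le> lab Q a"
      using clique_crossing[OF P(1) Q(1), of b a] P Q abc pos by auto
    then show ?thesis
      using lo_bounds(1)[of c P a] P Q abc by auto
  qed simp
next
  fix a b c
  assume abc: "1 \<le> a" "a < b" "b < c" "c \<le> n" and lt: "lo K b a < part s b"
  show "lo K c a \<le> lo K c b"
  proof (cases "lo K c a = 0")
    case False
    then obtain P where P: "P \<in> K" "c \<le> length P" "lab P a = 0" "lab P c = lo K c a"
      using lo_attained[of c a] abc by auto
    have "lab P b \<le> lo K b a"
      using lo_bounds(1)[of b P a] P abc by auto
    then have "lab P b = 0"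
      using route_inner[OF clique_route[OF P(1)], of b] lt P abc by auto
    then show ?thesis
      using lo_bounds(1)[of c P b] P abc by auto
  qed simp
qed auto

text \<open>All routes of \<open>K\<close> belong to the word \<open>w\<close> with inversion
  numbers \<open>lo K\<close>. It remains to see that a prefix whose route is missing from
  \<open>K\<close> ends inside an ascent; these ascents form \<open>A\<close>.\<close>

lemma cover_imp_face:
  assumes cover: "\<And>e. e \<in> arcs G \<Longrightarrow> \<exists>P\<in>K. e \<in> set P"
  shows "\<exists>w A. (w, A) \<in> perm_faces s \<and> face_routes w A = K"
proof -
  obtain w where w: "stirling s w" and inv: "\<And>a c. 1 \<le> a \<Longrightarrow> a < c \<Longrightarrow> c \<le> n \<Longrightarrow> inv_num w c a = lo K c a"
    using exists_word_lo by blast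
  have sub: "\<exists>q\<le>length w. agrees w q P" if P: "P \<in> K" for P
  proof -
    have "P \<in> word_routes w"
      unfolding word_routes_iff[OF w clique_route[OF P]]
    proof (intro allI impI conjI; elim conjE)
      fix a c assume ac: "1 \<le> a" "a < c" "c \<le> length P" "c \<le> n"
      {
        assume "lab P a = 0"
        then show "lab P c \<le> inv_num w c a" using lo_bounds(1)[of c P a] P ac inv by auto
      next
        assume full: "lab P a = part s a"
        show "inv_num w c a \<le> lab P c"
        proof (cases "lo K c a = 0")
          case False
          then obtain Q where Q: "Q \<in> K" "c \<le> length Q" "lab Q a = 0" "lab Q c = lo K c a"
            using lo_attained[of c a] ac by auto
          then show ?thesis
            using clique_crossing[OF Q(1) P, of a c] full part_pos[of a] ac inv by auto
        qed (use inv ac in auto)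
      }
    qed
    then show ?thesis by (simp add: word_routes_def)
  qed
  \<comment> \<open>If only the prefix \<open>p\<close> has exactly \<open>t\<close> copies of
    \<open>i\<close>, then any route of \<open>K\<close> through the edge \<open>(i, t)\<close> must
    be the route of \<open>p\<close>.\<close>
  have at_cut: "\<exists>Q\<in>K. agrees w p Q"
    if arc: "(i, t) \<in> arcs G" and i: "i \<le> n" and "p \<le> length w" and t: "t = cnt w p i"
      and less: "\<And>q. q < p \<Longrightarrow> cnt w q i \<noteq> t" and gt: "\<And>q. p < q \<Longrightarrow> q \<le> length w \<Longrightarrow> cnt w q i \<noteq> t" for i t p
  proof -
    obtain Q where Q: "Q \<in> K" "(i, t) \<in> set Q" using cover[OF arc] by blast
    then obtain q where q: "q \<le> length w" "agrees w q Q" using sub by blast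
    have "1 \<le> i \<and> i \<le> length Q \<and> lab Q i = t"
      using Q edge_mem_route_iff[OF clique_route[OF Q(1)]] by simp
    then have "cnt w q i = t" using agrees_lab[OF q(2)] i by auto
    then have "q = p" using less gt q(1) by (metis linorder_neqE_nat)
    then show ?thesis using Q q by blast
  qed
  have non_ascent: "\<exists>Q\<in>K. agrees w p Q"
    if p: "p \<le> length w" "\<not> (0 < p \<and> p < length w \<and> w ! (p - 1) < w ! p)" for p
  proof -
    \<comment> \<open>The forcing edges are the bump of the first letter, the dip of the last
      letter, and a source-edge between two equal letters. A descent needs the minimality of
      \<open>w\<close> instead.\<close>
    consider "length w = 0" | "p = 0" "0 < length w" | "p = length w" "0 < length w"
      | "0 < p" "p < length w" "w ! p = w ! (p - 1)" | "0 < p" "p < length w" "w ! p < w ! (p - 1)"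
      using p by linarith
    then show ?thesis
    proof cases
      case 1
      have "(Suc n, 1) \<in> arcs G" by (simp add: flow_graph_def source_edges_def)
      then obtain Q where "Q \<in> K" using cover by blast
      then show ?thesis using sub[of Q] p 1 by auto
    next
      case 2
      let ?c = "w ! 0"
      have c: "1 \<le> ?c" "?c \<le> n" using letter[OF w 2(2)] by auto
      show ?thesis
      proof (rule at_cut[of ?c 0])
        show "(?c, 0) \<in> arcs G" using inner_arcI(1)[of "(?c, 0)"] c by simp
        fix q assume "p < q" "q \<le> length w"
        then show "cnt w q ?c \<noteq> 0"
          using cnt_mono[of "Suc 0" q w ?c] cnt_Suc[OF 2(2), of ?c] by auto
      qed (use 2 c in auto)
    next
      case 3
      let ?a = "w ! (p - 1)"
      have a: "1 \<le> ?a" "?a \<le> n" using letter[OF w, of "p - 1"] 3 by auto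
      show ?thesis
      proof (rule at_cut[of ?a "part s ?a"])
        show "(?a, part s ?a) \<in> arcs G" using inner_arcI(1)[of "(?a, part s ?a)"] a by simp
        show full: "part s ?a = cnt w p ?a" using cnt_full[OF w a] 3 by simp
        fix q assume "q < p"
        then have "cnt w q ?a \<le> cnt w (p - 1) ?a" by (intro cnt_mono) simp
        then show "cnt w q ?a \<noteq> part s ?a"
          using cnt_pred[of p w ?a] 3 full by auto
      qed (use 3 a in auto)
    next
      case 4
      let ?a = "w ! (p - 1)"
      have a: "1 \<le> ?a" "?a \<le> n" using letter[OF w, of "p - 1"] 4 by auto
      have before: "cnt w p ?a = Suc (cnt w (p - 1) ?a)" using cnt_pred[of p w ?a] 4 by simp
      have after: "cnt w (Suc p) ?a = Suc (cnt w p ?a)" using cnt_Suc[of p w ?a] 4 by simp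
      show ?thesis
      proof (rule at_cut[of ?a "cnt w p ?a"])
        have "(?a, cnt w p ?a) \<in> source_edges s"
          using before after cnt_part[OF w a, of "Suc p"] a by (simp add: source_edge_iff)
        then show "(?a, cnt w p ?a) \<in> arcs G" using source_arcI by blast
      next
        fix q assume "q < p"
        then have "cnt w q ?a \<le> cnt w (p - 1) ?a" by (intro cnt_mono) simp
        then show "cnt w q ?a \<noteq> cnt w p ?a" using before by simp
      next
        fix q assume "p < q"
        then have "cnt w (Suc p) ?a \<le> cnt w q ?a" by (intro cnt_mono) simp
        then show "cnt w q ?a \<noteq> cnt w p ?a" using after by simp
      qed (use 4 a in auto)
    next
      case 5
      let ?a = "w ! (p - 1)" and ?c = "w ! p"
      have ac: "1 \<le> ?c" "?c < ?a" "?a \<le> n"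
        using letter[OF w, of "p - 1"] letter[OF w, of p] 5 by auto
      have before: "cnt w p i = cnt w (p - 1) i + (if ?a = i then 1 else 0)" for i
        using cnt_pred[of p w i] 5 by simp
      have after: "cnt w (Suc p) i = cnt w p i + (if ?c = i then 1 else 0)" for i
        using cnt_Suc[of p w i] 5 by simp
      have lt: "cnt w p ?c < part s ?c"
        using after[of ?c] cnt_part[OF w, of ?c "Suc p"] ac by simp
      then have c0: "cnt w p ?c = 0"
        using closed_after_letter[OF w 5(1), of ?c] 5 ac by auto
      \<comment> \<open>The \<open>?c\<close>-block starts at \<open>p\<close>, so
        \<open>lo K ?a ?c\<close> is positive and attained by a route of \<open>K\<close>. Its
        prefix has no \<open>?c\<close>, so it ends no later than \<open>p\<close>, and all
        \<open>?a\<close> read up to \<open>p\<close>, so no earlier.\<close>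
      have "inv_num w ?a ?c = cnt w p ?a"
        using cnt_inv[OF w ac lt] inv_num_le_cnt[of "Suc p" w ?c ?a] after[of ?c] after[of ?a] ac by simp
      then have lo: "lo K ?a ?c = cnt w p ?a" "0 < cnt w p ?a"
        using inv[OF ac] before[of ?a] by auto
      then obtain Q where Q: "Q \<in> K" "?a \<le> length Q" "lab Q ?c = 0" "lab Q ?a = cnt w p ?a"
        using lo_attained[of ?a ?c] ac by auto
      then obtain q where q: "q \<le> length w" "agrees w q Q" using sub by blast
      then have cq: "cnt w q ?c = 0" "cnt w q ?a = cnt w p ?a"
        using agrees_lab[OF q(2)] Q ac by auto
      have "\<not> q \<le> p - 1"
        using cnt_mono[of q "p - 1" w ?a] cq before[of ?a] by auto
      moreover have "\<not> Suc p \<le> q"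
        using cnt_mono[of "Suc p" q w ?c] cq after[of ?c] by auto
      ultimately have "q = p" by linarith
      then show ?thesis using Q q by blast
    qed
  qed
  define A where "A = {(w ! (p - 1), w ! p) | p. 0 < p \<and> p < length w \<and> w ! (p - 1) < w ! p \<and>
    \<not> (\<exists>Q\<in>K. agrees w p Q)}"
  have "A \<subseteq> ascents w"
  proof
    fix x assume "x \<in> A"
    then obtain p where p: "x = (w ! (p - 1), w ! p)" "0 < p" "p < length w" "w ! (p - 1) < w ! p"
      by (auto simp: A_def)
    have "w = take (p - 1) w @ [w ! (p - 1), w ! p] @ drop (Suc p) w"
      using p by (metis Cons_nth_drop_Suc Suc_diff_1 append_Cons append_Nil append_take_drop_id less_imp_diff_less)
    then have "sublist [w ! (p - 1), w ! p] w" unfolding sublist_def by blast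
    then show "x \<in> ascents w" using p by (simp add: ascents_def)
  qed
  then have face: "(w, A) \<in> perm_faces s" using w by (simp add: perm_faces_def)
  have cuts: "p \<in> ascent_cuts w A \<longleftrightarrow>
    0 < p \<and> p < length w \<and> w ! (p - 1) < w ! p \<and> \<not> (\<exists>Q\<in>K. agrees w p Q)" for p
  proof
    assume "p \<in> ascent_cuts w A"
    then obtain q where p: "0 < p" "p < length w" and q: "w ! (p - 1) = w ! (q - 1)" "w ! p = w ! q"
      "0 < q" "q < length w" "w ! (q - 1) < w ! q" "\<not> (\<exists>Q\<in>K. agrees w q Q)"
      unfolding ascent_cuts_def A_def by auto
    have "q = p" using ascent_position_unique[OF w q(3-5) p q(1,2)] .
    then show "0 < p \<and> p < length w \<and> w ! (p - 1) < w ! p \<and> \<not> (\<exists>Q\<in>K. agrees w p Q)"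
      using q by simp
  qed (auto simp: ascent_cuts_def A_def)
  have "face_routes w A = K"
  proof (intro equalityI subsetI)
    fix P assume "P \<in> face_routes w A"
    then obtain p where p: "p \<le> length w" "p \<notin> ascent_cuts w A" "agrees w p P"
      by (auto simp: face_routes_def)
    then have "\<exists>Q\<in>K. agrees w p Q" using cuts[of p] non_ascent[OF p(1)] by blast
    then show "P \<in> K" using agrees_unique[OF p(3)] by blast
  next
    fix P assume P: "P \<in> K"
    then obtain p where "p \<le> length w" "agrees w p P" using sub by blast
    then show "P \<in> face_routes w A" using cuts[of p] P by (auto simp: face_routes_def)
  qed
  then show ?thesis using face by blast
qed

end

end

section \<open>Cells of the mixed subdivision\<close>

lemma sum_fun_apply: "(\<Sum>a\<in>A. f a) x = (\<Sum>a\<in>A. f a x)"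
  by (induction A rule: infinite_finite_induct) auto

text \<open>The coordinates are rounded one at a time: \<open>x\<close> is a convex combination of
  \<open>x(m := 0)\<close> and \<open>x(m := 1)\<close>.\<close>

lemma cube_eq: "cube k = {x. (\<forall>i<k. 0 \<le> x i \<and> x i \<le> 1) \<and> (\<forall>i\<ge>k. x i = 0)}" (is "_ = ?B")
proof
  have "convex ?B"
    by (intro convexI) (auto simp: scaleR_fun_def intro!: convex_bound_le)
  then show "cube k \<subseteq> ?B"
    unfolding cube_def by (intro hull_minimal) force+
  have "x \<in> cube k"
    if "m \<le> k" "x \<in> ?B" "\<forall>i. m \<le> i \<and> i < k \<longrightarrow> x i \<in> {0, 1}" for x m
    using that
  proof (induction m arbitrary: x)
    case 0
    then show ?case
      unfolding cube_def by (intro hull_inc) auto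
  next
    case (Suc m)
    have x01: "0 \<le> x m" "x m \<le> 1" using Suc.prems by auto
    have "x(m := 0) \<in> cube k"
      by (rule Suc.IH) (use Suc.prems in \<open>auto simp: Suc_le_eq dest: le_neq_implies_less\<close>)
    moreover have "x(m := 1) \<in> cube k"
      by (rule Suc.IH) (use Suc.prems in \<open>auto simp: Suc_le_eq dest: le_neq_implies_less\<close>)
    ultimately have "(1 - x m) *\<^sub>R (x(m := 0)) + x m *\<^sub>R (x(m := 1)) \<in> cube k"
      using x01 unfolding cube_def by (intro convexD[OF convex_convex_hull]) auto
    also have "(1 - x m) *\<^sub>R (x(m := 0)) + x m *\<^sub>R (x(m := 1)) = x"
      by (auto simp: scaleR_fun_def fun_eq_iff algebra_simps)
    finally show ?case .
  qed
  then show "?B \<subseteq> cube k"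
    by (metis (no_types, lifting) leD le_refl subsetI)
qed

section \<open>Flows carried by cliques\<close>

definition flow :: "edge list set \<Rightarrow> (edge list \<Rightarrow> real) \<Rightarrow> edge \<Rightarrow> real" where
  "flow K \<mu> e = (\<Sum>P\<in>K. \<mu> P * route_vec P e)"

definition top_edge :: "edge list \<Rightarrow> edge" where
  "top_edge P = (length P, lab P (length P))"

lemma flow_pos:
  assumes "finite K" "\<And>P. P \<in> K \<Longrightarrow> 0 < \<mu> P" "P \<in> K" "e \<in> set P"
  shows "0 < flow K \<mu> e"
  unfolding flow_def using assms
  by (intro sum_pos2[of K P]) (auto simp: route_vec_def less_imp_le)

lemma flow_nonneg: "(\<And>P. P \<in> K \<Longrightarrow> 0 \<le> \<mu> P) \<Longrightarrow> 0 \<le> flow K \<mu> e"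
  unfolding flow_def by (intro sum_nonneg) (auto simp: route_vec_def)

lemma flow_eq_0: "(\<And>P. P \<in> K \<Longrightarrow> e \<notin> set P) \<Longrightarrow> flow K \<mu> e = 0"
  unfolding flow_def by (intro sum.neutral) (auto simp: route_vec_def)

lemma flow_remove:
  "finite K \<Longrightarrow> R \<in> K \<Longrightarrow> flow (K - {R}) \<mu> e = flow K \<mu> e - \<mu> R * route_vec R e"
  unfolding flow_def by (simp add: sum.remove)

lemma flow_update:
  assumes "finite K" "R \<in> K"
  shows "flow K (\<mu>(R := t)) e = flow K \<mu> e + (t - \<mu> R) * route_vec R e"
proof -
  have "(\<Sum>P\<in>K - {R}. (\<mu>(R := t)) P * route_vec P e) = (\<Sum>P\<in>K - {R}. \<mu> P * route_vec P e)"
    by (rule sum.cong) auto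
  then show ?thesis
    unfolding flow_def using assms by (simp add: sum.remove algebra_simps)
qed

context composition
begin

abbreviation "S \<equiv> source_edges s"
abbreviation "N \<equiv> num_sources s"

lemma route_arcs: "P \<in> routes s \<Longrightarrow> set P \<subseteq> arcs G"
  by (auto simp: routes_def pre_digraph.apath_def pre_digraph.awalk_def)

lemma clique_subset: "clique s K \<Longrightarrow> K' \<subseteq> K \<Longrightarrow> clique s K'"
  unfolding clique_iff by blast

lemma clique_finite: "clique s K \<Longrightarrow> finite K"
  unfolding clique_iff using finite_routes finite_subset by blast

text \<open>The new route \<open>P\<close> is compared only with the old minimum \<open>R\<close>;
  \<open>below_cycle_imp_eq\<close> excludes a \<open>Q\<close> with \<open>P\<close> below
  \<open>R\<close>, \<open>R\<close> below \<open>Q\<close> and \<open>Q\<close> below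
  \<open>P\<close>.\<close>

lemma clique_minimum:
  assumes "finite K" "K \<noteq> {}" "clique s K"
  shows "\<exists>R\<in>K. \<forall>Q\<in>K. below R Q"
  using assms
proof (induction K rule: finite_ne_induct)
  case (singleton P)
  then show ?case by (simp add: below_refl)
next
  case (insert P K)
  have "clique s K" using insert.prems by (rule clique_subset) blast
  then obtain R where R: "R \<in> K" "\<forall>Q\<in>K. below R Q" using insert.IH by blast
  have routes: "insert P K \<subseteq> routes s"
    and chain: "\<forall>P'\<in>insert P K. \<forall>Q\<in>insert P K. below P' Q \<or> below Q P'"
    using insert.prems by (auto simp: clique_iff)
  show ?case
  proof (cases "below R P")
    case True
    then show ?thesis using R by (intro bexI[of _ R]) auto
  next
    case False
    then have PR: "below P R" using chain R(1) by blast
    have "below P Q" if Q: "Q \<in> K" for Q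
    proof (rule ccontr)
      assume "\<not> below P Q"
      then have "below Q P" using chain Q by blast
      then have "P = Q"
        using below_cycle_imp_eq[of P Q R] routes Q R PR by auto
      then show False using insert.hyps Q by simp
    qed
    then show ?thesis by (intro bexI[of _ P]) (auto simp: below_refl)
  qed
qed

text \<open>
  The minimum of a clique uses at every vertex, read backwards from the sink, the lowest incoming
  edge that carries flow; so the flow determines it, and it can be peeled off.
\<close>

lemma flow_determines_clique:
  assumes "clique s K" "clique s K'" "\<And>P. P \<in> K \<Longrightarrow> 0 < \<mu> P" "\<And>P. P \<in> K' \<Longrightarrow> 0 < \<mu>' P"
    "\<And>e. e \<in> arcs G \<Longrightarrow> flow K \<mu> e = flow K' \<mu>' e"
  shows "K = K'"
  using assms
proof (induction "card K + card K'" arbitrary: K K' \<mu> \<mu>' rule: less_induct)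
  case less
  have nonempty: "L' = {}"
    if "L = {}" "clique s L'" "\<And>P. P \<in> L' \<Longrightarrow> 0 < \<nu>' P" "\<And>e. e \<in> arcs G \<Longrightarrow> flow L \<nu> e = flow L' \<nu>' e"
    for L L' \<nu> \<nu>'
  proof (rule ccontr)
    assume "L' \<noteq> {}"
    then obtain P where P: "P \<in> L'" by blast
    then have PR: "P \<in> routes s" using that(2) by (auto simp: clique_iff)
    then have "P \<noteq> []" using route_length by force
    then have hd: "hd P \<in> set P" by simp
    then have "0 < flow L' \<nu>' (hd P)"
      using flow_pos[OF clique_finite[OF that(2)] that(3) P hd] by simp
    moreover have "flow L' \<nu>' (hd P) = flow L \<nu> (hd P)"
      using that(4)[OF subsetD[OF route_arcs[OF PR] hd]] by simp
    ultimately show False using that(1) by (simp add: flow_def)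
  qed
  \<comment> \<open>Each edge of \<open>R'\<close> carries flow, so some route of \<open>L\<close>
    uses it, and the minimum \<open>R\<close> lies below that route.\<close>
  have le_lab: "lab R i \<le> lab R' i"
    if L: "clique s L" "clique s L'" "\<And>P. P \<in> L' \<Longrightarrow> 0 < \<nu>' P"
      and eq: "\<And>e. e \<in> arcs G \<Longrightarrow> flow L \<nu> e = flow L' \<nu>' e"
      and R: "R \<in> L" "\<forall>Q\<in>L. below R Q" "R' \<in> L'" and i: "1 \<le> i" "i \<le> length R" "i \<le> length R'"
    for L L' \<nu> \<nu>' R R' i
  proof -
    have R': "R' \<in> routes s" using L(2) R(3) by (auto simp: clique_iff)
    have mem: "(i, lab R' i) \<in> set R'" using edge_mem_route_iff[OF R'] i by simp
    have "0 < flow L' \<nu>' (i, lab R' i)"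
      using flow_pos[OF clique_finite[OF L(2)] L(3) R(3) mem] by simp
    moreover have "(i, lab R' i) \<in> arcs G" using mem route_arcs[OF R'] by blast
    ultimately have "flow L \<nu> (i, lab R' i) \<noteq> 0" using eq by simp
    then obtain Q where Q: "Q \<in> L" "(i, lab R' i) \<in> set Q" using flow_eq_0 by blast
    then have "Q \<in> routes s" using L(1) by (auto simp: clique_iff)
    then have "i \<le> length Q" "lab Q i = lab R' i" using Q(2) edge_mem_route_iff by auto
    then show ?thesis using R(2) Q(1) i unfolding below_def by metis
  qed
  show ?case
  proof (cases "K = {} \<or> K' = {}")
    case True
    then show ?thesis
      using nonempty[of K K' \<mu>' \<mu>] nonempty[of K' K \<mu> \<mu>'] less.prems by auto
  next
    case False
    obtain R where R: "R \<in> K" "\<forall>Q\<in>K. below R Q"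
      using clique_minimum[OF clique_finite] less.prems(1) False by blast
    obtain R' where R': "R' \<in> K'" "\<forall>Q\<in>K'. below R' Q"
      using clique_minimum[OF clique_finite] less.prems(2) False by blast
    have "R = R'"
    proof (rule route_eqI)
      show "R \<in> routes s" "R' \<in> routes s" using R R' less.prems by (auto simp: clique_iff)
      fix i assume i: "1 \<le> i" "i \<le> length R" "i \<le> length R'"
      show "lab R i = lab R' i"
      proof (rule antisym)
        show "lab R i \<le> lab R' i"
          using le_lab[OF less.prems(1,2,4,5) R R'(1)] i by simp
        show "lab R' i \<le> lab R i"
          using le_lab[OF less.prems(2,1,3) less.prems(5)[symmetric] R' R(1)] i by simp
      qed
    qed
    then have RK': "R \<in> K'" using R' by simp
    have fin: "finite K" "finite K'" using less.prems clique_finite by auto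
    have card: "card (K - {R}) < card K" "card (K' - {R}) < card K'"
      using card_Diff1_less[OF fin(1) R(1)] card_Diff1_less[OF fin(2) RK'] by simp_all
    have cl: "clique s (K - {R})" "clique s (K' - {R})"
      using less.prems clique_subset by blast+
    \<comment> \<open>The smaller weight of \<open>R\<close> is subtracted on both sides, which
      removes \<open>R\<close> where its weight vanishes. With unequal weights the induction would
      put \<open>R\<close> into only one of two equal sets.\<close>
    consider "\<mu> R = \<mu>' R" | "\<mu> R < \<mu>' R" | "\<mu>' R < \<mu> R" by linarith
    then show ?thesis
    proof cases
      case 1
      have "K - {R} = K' - {R}"
      proof (rule less.hyps[of "K - {R}" "K' - {R}" \<mu> \<mu>'])
        show "card (K - {R}) + card (K' - {R}) < card K + card K'" using card by linarith
        fix e assume "e \<in> arcs G"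
        then show "flow (K - {R}) \<mu> e = flow (K' - {R}) \<mu>' e"
          using flow_remove[OF fin(1) R(1)] flow_remove[OF fin(2) RK'] less.prems(5) 1 by simp
      qed (use cl less.prems in auto)
      then show ?thesis using R RK' by blast
    next
      case 2
      have "K - {R} = K'"
      proof (rule less.hyps[of "K - {R}" K' \<mu> "\<mu>'(R := \<mu>' R - \<mu> R)"])
        show "card (K - {R}) + card K' < card K + card K'" using card by linarith
        fix e assume "e \<in> arcs G"
        then show "flow (K - {R}) \<mu> e = flow K' (\<mu>'(R := \<mu>' R - \<mu> R)) e"
          using flow_remove[OF fin(1) R(1)] flow_update[OF fin(2) RK'] less.prems(5) by simp
      qed (use cl less.prems 2 in auto)
      then show ?thesis using RK' by blast
    next
      case 3
      have "K = K' - {R}"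
      proof (rule less.hyps[of K "K' - {R}" "\<mu>(R := \<mu> R - \<mu>' R)" \<mu>'])
        show "card K + card (K' - {R}) < card K + card K'" using card by linarith
        fix e assume "e \<in> arcs G"
        then show "flow K (\<mu>(R := \<mu> R - \<mu>' R)) e = flow (K' - {R}) \<mu>' e"
          using flow_remove[OF fin(2) RK'] flow_update[OF fin(1) R(1)] less.prems(5) by simp
      qed (use cl less.prems 3 in auto)
      then show ?thesis using R by blast
    qed
  qed
qed

lemma source_edges_Sigma: "S = Sigma {1..Suc n} (\<lambda>i. {1..part s i - 1})"
  by (auto simp: source_edges_def)

lemma finite_source [simp]: "finite S"
  by (simp add: source_edges_Sigma)

lemma card_source: "card S = N"
  by (simp add: source_edges_Sigma num_sources_def)

lemma N_pos: "0 < real N"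
proof -
  have "0 < N" unfolding num_sources_def by linarith
  then show ?thesis by simp
qed

lemma top_edge_source: "P \<in> routes s \<Longrightarrow> top_edge P \<in> S"
  using route_length[of P] route_top[of P] by (simp add: source_edge_iff top_edge_def)

lemma source_mem_route_iff:
  assumes P: "P \<in> routes s" and e: "e \<in> S"
  shows "e \<in> set P \<longleftrightarrow> e = top_edge P"
proof -
  obtain i t where it: "e = (i, t)" by fastforce
  then have *: "1 \<le> i" "0 < t" "t < part s i" using e by (auto simp: source_edge_iff)
  have "i = length P" if "i \<le> length P" "lab P i = t"
    using route_inner[OF P *(1)] that * by (cases "i = length P") auto
  then show ?thesis
    using edge_mem_route_iff[OF P] route_length[OF P] * it by (auto simp: top_edge_def)
qed

lemma sum_route_vec_source:
  assumes "P \<in> routes s" "B \<subseteq> S"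
  shows "(\<Sum>e\<in>B. route_vec P e) = (if top_edge P \<in> B then 1 else 0)"
proof -
  have "(\<Sum>e\<in>B. route_vec P e) = (\<Sum>e\<in>B. if e = top_edge P then 1 else 0)"
    by (intro sum.cong refl)
      (simp add: route_vec_def source_mem_route_iff[OF assms(1)] subsetD[OF assms(2)])
  also have "\<dots> = (if top_edge P \<in> B then 1 else 0)"
    using finite_subset[OF assms(2) finite_source] by simp
  finally show ?thesis .
qed

lemma sum_flow_source:
  assumes "K \<subseteq> routes s" "B \<subseteq> S"
  shows "(\<Sum>e\<in>B. flow K \<mu> e) = (\<Sum>P\<in>K. \<mu> P * (if top_edge P \<in> B then 1 else 0))"
proof -
  have "(\<Sum>e\<in>B. flow K \<mu> e) = (\<Sum>P\<in>K. \<mu> P * (\<Sum>e\<in>B. route_vec P e))"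
    unfolding flow_def by (subst sum.swap) (simp add: sum_distrib_left)
  also have "\<dots> = (\<Sum>P\<in>K. \<mu> P * (if top_edge P \<in> B then 1 else 0))"
    using assms sum_route_vec_source by (intro sum.cong) auto
  finally show ?thesis .
qed

text \<open>The source-edges that enter the graph at or before the common tail of the bump and the
  dip of index \<open>i\<close>; flow from them crosses exactly one of these two.\<close>

definition sources_above :: "nat \<Rightarrow> edge set" where
  "sources_above i = {e \<in> S. i < fst e}"

lemma flow_conservation:
  assumes K: "K \<subseteq> routes s" and i: "1 \<le> i" "i \<le> n"
  shows "flow K \<mu> (i, 0) + flow K \<mu> (i, part s i) = (\<Sum>e\<in>sources_above i. flow K \<mu> e)"
proof -
  have "route_vec P (i, 0) + route_vec P (i, part s i) = (if top_edge P \<in> sources_above i then 1 else 0)"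
    if P: "P \<in> K" for P
  proof -
    have PR: "P \<in> routes s" using K P by blast
    have top: "top_edge P \<in> sources_above i \<longleftrightarrow> i < length P"
      using top_edge_source[OF PR] by (simp add: sources_above_def top_edge_def)
    have part: "0 < part s i" using part_pos i by simp
    consider "i < length P" | "i = length P" | "length P < i" by linarith
    then show ?thesis
    proof cases
      case 1
      then have "lab P i = 0 \<or> lab P i = part s i" using route_inner[OF PR i(1)] by simp
      then show ?thesis
        using 1 i part top by (auto simp: route_vec_def edge_mem_route_iff[OF PR])
    next
      case 2
      then show ?thesis
        using route_top[OF PR] top by (auto simp: route_vec_def edge_mem_route_iff[OF PR])
    next
      case 3
      then show ?thesis
        using top by (auto simp: route_vec_def edge_mem_route_iff[OF PR])
    qed
  qed
  then have "flow K \<mu> (i, 0) + flow K \<mu> (i, part s i) =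
      (\<Sum>P\<in>K. \<mu> P * (if top_edge P \<in> sources_above i then 1 else 0))"
    unfolding flow_def sum.distrib[symmetric] distrib_left[symmetric] by (intro sum.cong) auto
  then show ?thesis
    using sum_flow_source[OF K, of "sources_above i"] by (simp add: sources_above_def)
qed

text \<open>On the Cayley slice the bump coordinates thus determine the dips, so a point of a cell
  determines the flow on all edges.\<close>

lemma flow_dip:
  assumes K: "K \<subseteq> routes s" and i: "1 \<le> i" "i \<le> n" and src: "\<And>e. e \<in> S \<Longrightarrow> flow K \<mu> e = 1 / real N"
  shows "flow K \<mu> (i, 0) + flow K \<mu> (i, part s i) = real (card (sources_above i)) / real N"
proof -
  have "(\<Sum>e\<in>sources_above i. flow K \<mu> e) = (\<Sum>e\<in>sources_above i. 1 / real N)"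
    by (intro sum.cong) (auto simp: src sources_above_def)
  then show ?thesis
    using flow_conservation[OF K i] by simp
qed

section \<open>Cells as slices, and inclusion of cells\<close>

definition cell :: "edge list set \<Rightarrow> (nat \<Rightarrow> real) set" where
  "cell K = mixed_cell s (convex hull (route_vec ` K))"

lemma inj_route_vec: "inj_on route_vec (routes s)"
proof (rule inj_onI)
  fix P Q assume P: "P \<in> routes s" and Q: "Q \<in> routes s" and eq: "route_vec P = route_vec Q"
  have mem: "e \<in> set P \<longleftrightarrow> e \<in> set Q" for e
    using fun_cong[OF eq, of e] by (auto simp: route_vec_def split: if_splits)
  show "P = Q"
  proof (rule route_eqI[OF P Q])
    fix i assume "1 \<le> i" "i \<le> length P" "i \<le> length Q"
    then show "lab P i = lab Q i"
      using mem[of "(i, lab P i)"] edge_mem_route_iff[OF P] edge_mem_route_iff[OF Q] by simp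
  qed
qed

lemma convex_hull_route_vec:
  assumes K: "K \<subseteq> routes s"
  shows "convex hull (route_vec ` K) =
    {flow K \<mu> | \<mu>. (\<forall>P\<in>K. 0 \<le> \<mu> P) \<and> sum \<mu> K = 1}"
proof -
  have fin: "finite K" using K finite_routes finite_subset by blast
  have inj: "inj_on route_vec K" using K inj_route_vec inj_on_subset by blast
  have sum_eq: "(\<Sum>P\<in>K. \<mu> P *\<^sub>R route_vec P) = flow K \<mu>" for \<mu>
    by (simp add: fun_eq_iff flow_def sum_fun_apply scaleR_fun_def)
  show ?thesis
    unfolding convex_hull_finite[OF finite_imageI[OF fin]]
  proof (intro equalityI subsetI; elim CollectE exE conjE)
    fix f u
    assume u: "\<forall>x\<in>route_vec ` K. 0 \<le> u x" "sum u (route_vec ` K) = 1" "(\<Sum>x\<in>route_vec ` K. u x *\<^sub>R x) = f"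
    then have "f = flow K (u \<circ> route_vec)" "sum (u \<circ> route_vec) K = 1" "\<forall>P\<in>K. 0 \<le> (u \<circ> route_vec) P"
      using sum_eq[of "u \<circ> route_vec"] by (auto simp: sum.reindex[OF inj])
    then show "f \<in> {flow K \<mu> | \<mu>. (\<forall>P\<in>K. 0 \<le> \<mu> P) \<and> sum \<mu> K = 1}" by blast
  next
    fix f \<mu> assume \<mu>: "f = flow K \<mu>" "\<forall>P\<in>K. 0 \<le> \<mu> P" "sum \<mu> K = 1"
    let ?u = "\<mu> \<circ> the_inv_into K route_vec"
    have u: "?u (route_vec P) = \<mu> P" if "P \<in> K" for P
      using the_inv_into_f_f[OF inj that] by simp
    have "sum ?u (route_vec ` K) = (\<Sum>P\<in>K. ?u (route_vec P))"
      "(\<Sum>x\<in>route_vec ` K. ?u x *\<^sub>R x) = (\<Sum>P\<in>K. ?u (route_vec P) *\<^sub>R route_vec P)"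
      by (simp_all only: sum.reindex[OF inj] comp_def)
    moreover have "(\<Sum>P\<in>K. ?u (route_vec P)) = sum \<mu> K"
      "(\<Sum>P\<in>K. ?u (route_vec P) *\<^sub>R route_vec P) = (\<Sum>P\<in>K. \<mu> P *\<^sub>R route_vec P)"
      using u by (auto intro!: sum.cong simp del: comp_apply)
    ultimately have "sum ?u (route_vec ` K) = 1" "(\<Sum>x\<in>route_vec ` K. ?u x *\<^sub>R x) = f"
      using \<mu> sum_eq[of \<mu>] by simp_all
    moreover have "\<forall>x\<in>route_vec ` K. 0 \<le> ?u x"
      using u \<mu>(2) by (simp del: comp_apply)
    ultimately show "f \<in> {y. \<exists>u. (\<forall>x\<in>route_vec ` K. 0 \<le> u x) \<and> sum u (route_vec ` K) = 1 \<and>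
        (\<Sum>x\<in>route_vec ` K. u x *\<^sub>R x) = y}" by blast
  qed
qed

lemma mem_cell_iff:
  assumes "K \<subseteq> routes s"
  shows "x \<in> cell K \<longleftrightarrow> (\<exists>\<mu>. (\<forall>P\<in>K. 0 \<le> \<mu> P) \<and> sum \<mu> K = 1 \<and> (\<forall>e\<in>S. flow K \<mu> e = 1 / real N) \<and>
    x = (\<lambda>i. if i < n then real N * flow K \<mu> (Suc i, 0) else 0))"
proof -
  have slice: "cayley_proj s f \<in> cayley_slice s \<longleftrightarrow> (\<forall>e\<in>S. f e = 1 / real N)" for f
    by (auto simp: cayley_proj_def cayley_slice_def topspace_Euclidean_space fun_eq_iff)
  have snd: "real N *\<^sub>R snd (cayley_proj s f) = (\<lambda>i. if i < n then real N * f (Suc i, 0) else 0)" for f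
    by (auto simp: cayley_proj_def scaleR_fun_def)
  have "x \<in> cell K \<longleftrightarrow> (\<exists>f\<in>convex hull (route_vec ` K). (\<forall>e\<in>S. f e = 1 / real N) \<and>
      x = (\<lambda>i. if i < n then real N * f (Suc i, 0) else 0))"
    unfolding cell_def mixed_cell_def slice[symmetric] snd[symmetric] by blast
  then show ?thesis
    unfolding convex_hull_route_vec[OF assms] by blast
qed

lemma cell_mono: "K \<subseteq> K' \<Longrightarrow> cell K \<subseteq> cell K'"
  unfolding cell_def mixed_cell_def by (intro image_mono Int_mono hull_mono subset_refl)

text \<open>The share \<open>1 / N\<close> of each source-edge is divided equally among the routes
  of \<open>K\<close> that start with it.\<close>

lemma positive_weights:
  assumes K: "K \<subseteq> routes s" and cover: "\<And>e. e \<in> S \<Longrightarrow> \<exists>P\<in>K. e \<in> set P"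
  obtains \<mu> where "\<And>P. P \<in> K \<Longrightarrow> 0 < \<mu> P" "sum \<mu> K = 1" "\<And>e. e \<in> S \<Longrightarrow> flow K \<mu> e = 1 / real N"
proof
  have fin: "finite K" using K finite_routes finite_subset by blast
  define C where "C e = {Q \<in> K. top_edge Q = e}" for e
  define \<mu> where "\<mu> P = 1 / (real N * real (card (C (top_edge P))))" for P
  have C_pos: "0 < card (C e)" if e: "e \<in> S" for e
    using cover[OF e] source_mem_route_iff[OF _ e] K fin by (auto simp: card_gt_0_iff C_def)
  show "0 < \<mu> P" if "P \<in> K" for P
    using C_pos[OF top_edge_source] that K N_pos by (auto simp: \<mu>_def)
  show src: "flow K \<mu> e = 1 / real N" if e: "e \<in> S" for e
  proof -
    have "flow K \<mu> e = (\<Sum>P\<in>K. if top_edge P = e then 1 / (real N * real (card (C e))) else 0)"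
      unfolding flow_def using source_mem_route_iff[OF _ e] K
      by (intro sum.cong) (auto simp: route_vec_def C_def \<mu>_def)
    also have "\<dots> = (\<Sum>P\<in>C e. 1 / (real N * real (card (C e))))"
      unfolding C_def by (rule sum.inter_filter[OF fin, symmetric])
    also have "\<dots> = 1 / real N" using C_pos[OF e] by simp
    finally show ?thesis .
  qed
  have "sum \<mu> K = (\<Sum>P\<in>K. \<mu> P * (if top_edge P \<in> S then 1 else 0))"
    using top_edge_source K by (intro sum.cong) auto
  also have "\<dots> = (\<Sum>e\<in>S. flow K \<mu> e)" using sum_flow_source[OF K subset_refl] by simp
  also have "\<dots> = (\<Sum>e\<in>S. 1 / real N)" using src by (intro sum.cong) auto
  also have "\<dots> = 1" using N_pos by (simp add: card_source)
  finally show "sum \<mu> K = 1" .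
qed

text \<open>Covering the source-edges makes the cell of \<open>K\<close> nonempty and provides a
  point with all weights positive. Writing this point in the cell of \<open>K'\<close> gives the
  same flow on every edge, so \<open>flow_determines_clique\<close> identifies \<open>K\<close> with
  the routes of positive weight in \<open>K'\<close>.\<close>

lemma cell_subset_imp_subset:
  assumes K: "clique s K" "\<And>e. e \<in> S \<Longrightarrow> \<exists>P\<in>K. e \<in> set P" and K': "clique s K'"
    and sub: "cell K \<subseteq> cell K'"
  shows "K \<subseteq> K'"
proof -
  have KR: "K \<subseteq> routes s" and KR': "K' \<subseteq> routes s" using K K' by (auto simp: clique_iff)
  obtain \<mu> where \<mu>: "\<And>P. P \<in> K \<Longrightarrow> 0 < \<mu> P" "sum \<mu> K = 1" "\<And>e. e \<in> S \<Longrightarrow> flow K \<mu> e = 1 / real N"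
    using positive_weights[OF KR K(2)] by blast
  let ?x = "\<lambda>i. if i < n then real N * flow K \<mu> (Suc i, 0) else 0"
  have "?x \<in> cell K"
    using \<mu> by (auto simp: mem_cell_iff[OF KR] less_imp_le intro!: exI[of _ \<mu>])
  then have "?x \<in> cell K'" using sub by blast
  then obtain \<mu>' where \<mu>': "\<And>P. P \<in> K' \<Longrightarrow> 0 \<le> \<mu>' P" "\<And>e. e \<in> S \<Longrightarrow> flow K' \<mu>' e = 1 / real N"
    and x: "?x = (\<lambda>i. if i < n then real N * flow K' \<mu>' (Suc i, 0) else 0)"
    unfolding mem_cell_iff[OF KR'] by blast
  have bump: "flow K \<mu> (i, 0) = flow K' \<mu>' (i, 0)" if "1 \<le> i" "i \<le> n" for i
  proof -
    obtain j where "i = Suc j" using \<open>1 \<le> i\<close> by (cases i) auto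
    then show ?thesis using fun_cong[OF x, of j] that N_pos by simp
  qed
  have dip: "flow K \<mu> (i, part s i) = flow K' \<mu>' (i, part s i)" if "1 \<le> i" "i \<le> n" for i
    using bump[OF that] flow_dip[OF KR that \<mu>(3)] flow_dip[OF KR' that \<mu>'(2)] by linarith
  define L where "L = {P \<in> K'. 0 < \<mu>' P}"
  have flow_L: "flow L \<mu>' e = flow K' \<mu>' e" for e
    unfolding flow_def
  proof (rule sum.mono_neutral_left)
    show "finite K'" using clique_finite[OF K'] .
    show "L \<subseteq> K'" by (auto simp: L_def)
    show "\<forall>P\<in>K' - L. \<mu>' P * route_vec P e = 0" using \<mu>'(1) by (force simp: L_def)
  qed
  have "K = L"
  proof (rule flow_determines_clique[of K L \<mu> \<mu>'])
    show "clique s L" using K' by (rule clique_subset) (auto simp: L_def)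
    fix e assume "e \<in> arcs G"
    then show "flow K \<mu> e = flow L \<mu>' e"
      unfolding flow_L
    proof (cases rule: arcs_cases)
      case 1
      then show "flow K \<mu> e = flow K' \<mu>' e" using \<mu>(3) \<mu>'(2) by simp
    next
      case 2
      then show "flow K \<mu> e = flow K' \<mu>' e" using bump dip by (cases e) auto
    qed
  qed (use K \<mu> in \<open>auto simp: L_def\<close>)
  then show ?thesis by (auto simp: L_def)
qed

section \<open>The sum of cubes as a coordinate box, and its frontier\<close>

definition coord_box :: "(nat \<Rightarrow> real) set" where
  "coord_box = {x. (\<forall>i<n. 0 \<le> x i \<and> x i \<le> real (card (sources_above (Suc i)))) \<and> (\<forall>i\<ge>n. x i = 0)}"

lemma card_sources_above_pos: "i \<le> n \<Longrightarrow> 0 < card (sources_above i)"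
proof -
  assume "i \<le> n"
  then have "(Suc n, 1) \<in> sources_above i" by (simp add: sources_above_def source_edge_iff)
  moreover have "finite (sources_above i)" by (simp add: sources_above_def)
  ultimately show ?thesis by (auto simp: card_gt_0_iff)
qed

text \<open>The single source-edge of upper index \<open>n + 1\<close> stands for the summand
  \<open>cube n\<close>, because \<open>part s (Suc n) = 2\<close>.\<close>

lemma cube_sum_source: "cube_sum s = (\<Sum>e\<in>S. cube (fst e - 1))"
proof -
  have "(\<Sum>e\<in>S. cube (fst e - 1)) = (\<Sum>k = 1..Suc n. \<Sum>t = 1..part s k - 1. cube (k - 1))"
    unfolding source_edges_Sigma by (subst sum.Sigma) (auto simp: case_prod_beta)
  then show ?thesis
    by (simp add: cube_sum_def add.commute)
qed

text \<open>The side in direction \<open>i\<close> counts the summands that extend in this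
  direction: those of the source-edges with upper index above \<open>Suc i\<close>, the upper index
  of the bump with coordinate \<open>i\<close>.\<close>

lemma cube_sum_eq_coord_box: "cube_sum s = coord_box"
proof -
  have sum: "cube_sum s = {sum z S | z. \<forall>e\<in>S. z e \<in> cube (fst e - 1)}"
    unfolding cube_sum_source by (rule set_sum_alt) simp
  have restrict: "(\<Sum>e\<in>S. if i < fst e - 1 then t else 0) = real (card (sources_above (Suc i))) * t" for i t
  proof -
    have "(\<Sum>e\<in>S. if i < fst e - 1 then t else 0) = (\<Sum>e\<in>sources_above (Suc i). t)"
      unfolding sources_above_def by (subst sum.inter_filter) (auto intro!: sum.cong)
    then show ?thesis by simp
  qed
  have above_empty: "sources_above (Suc i) = {}" if "n \<le> i" for i
    using that by (auto simp: sources_above_def source_edge_iff)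
  show ?thesis
    unfolding sum
  proof (intro equalityI subsetI; (elim CollectE exE conjE)?)
    fix x z assume x: "x = sum z S" and z: "\<forall>e\<in>S. z e \<in> cube (fst e - 1)"
    have xi: "x i = (\<Sum>e\<in>S. z e i)" for i by (simp add: x sum_fun_apply)
    have bounds: "0 \<le> z e i" "z e i \<le> (if i < fst e - 1 then 1 else 0)" if "e \<in> S" for e i
      using z that by (cases "i < fst e - 1"; force simp: cube_eq)+
    have ub: "x i \<le> real (card (sources_above (Suc i)))" for i
      unfolding xi using restrict[of i 1] bounds(2) by (metis (no_types, lifting) mult.right_neutral sum_mono)
    moreover have lb: "0 \<le> x i" for i unfolding xi using bounds(1) by (intro sum_nonneg)
    moreover have "x i = 0" if "n \<le> i" for i
      using ub[of i] lb[of i] above_empty[OF that] by simp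
    ultimately show "x \<in> coord_box" by (auto simp: coord_box_def)
  next
    fix x assume x: "x \<in> coord_box"
    \<comment> \<open>Each coordinate is shared equally among the cubes that extend in its
      direction.\<close>
    define z where "z e = (\<lambda>i. if i < fst e - 1 then x i / real (card (sources_above (Suc i))) else 0)" for e :: edge
    have "sum z S = x"
    proof
      fix i
      have "sum z S i = real (card (sources_above (Suc i))) * (x i / real (card (sources_above (Suc i))))"
        unfolding sum_fun_apply z_def by (rule restrict)
      also have "\<dots> = x i"
        using x card_sources_above_pos[of "Suc i"] above_empty[of i] by (cases "i < n") (auto simp: coord_box_def)
      finally show "sum z S i = x i" .
    qed
    moreover have "z e \<in> cube (fst e - 1)" if "e \<in> S" for e
    proof -
      have "0 \<le> z e i \<and> z e i \<le> 1" if "i < fst e - 1" for i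
      proof -
        have "i < n" using that \<open>e \<in> S\<close> by (auto simp: source_edge_iff)
        then show ?thesis
          using x card_sources_above_pos[of "Suc i"] that by (auto simp: z_def coord_box_def divide_le_eq)
      qed
      then show ?thesis by (auto simp: cube_eq z_def)
    qed
    ultimately show "x \<in> {sum z S | z. \<forall>e\<in>S. z e \<in> cube (fst e - 1)}" by blast
  qed
qed

lemma interior_of_coord_box:
  "Euclidean_space n interior_of coord_box =
     {x. (\<forall>i<n. 0 < x i \<and> x i < real (card (sources_above (Suc i)))) \<and> (\<forall>i\<ge>n. x i = 0)}" (is "_ = ?U")
proof
  have "continuous_map (Euclidean_space n) euclideanreal (\<lambda>x. x i)" for i
    unfolding Euclidean_space_def
    by (intro continuous_map_from_subtopology continuous_map_product_projection) simp
  then have "openin (Euclidean_space n) {x \<in> topspace (Euclidean_space n). x i \<in> {0<..<t}}" for i t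
    by (rule openin_continuous_map_preimage) simp
  then have "openin (Euclidean_space n) (topspace (Euclidean_space n) \<inter>
      (\<Inter>i\<in>{..<n}. {x \<in> topspace (Euclidean_space n). x i \<in> {0<..<real (card (sources_above (Suc i)))}}))"
    by (cases "n = 0") (auto intro!: openin_Int openin_INT)
  also have "topspace (Euclidean_space n) \<inter>
      (\<Inter>i\<in>{..<n}. {x \<in> topspace (Euclidean_space n). x i \<in> {0<..<real (card (sources_above (Suc i)))}}) = ?U"
    by (auto simp: topspace_Euclidean_space)
  finally show "?U \<subseteq> Euclidean_space n interior_of coord_box"
    by (intro interior_of_maximal) (auto simp: coord_box_def less_imp_le)
  show "Euclidean_space n interior_of coord_box \<subseteq> ?U"
  proof
    fix x assume x: "x \<in> Euclidean_space n interior_of coord_box"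
    then have xb: "x \<in> coord_box" by (rule subsetD[OF interior_of_subset])
    have "0 < x i \<and> x i < real (card (sources_above (Suc i)))" if i: "i < n" for i
    proof -
      \<comment> \<open>The line through \<open>x\<close> in direction \<open>i\<close>; zeros from
        coordinate \<open>n\<close> on keep it inside \<open>Euclidean_space n\<close>.\<close>
      define h where "h t = (\<lambda>j. if j < n then (if j = i then t else x j) else 0)" for t :: real
      have "continuous_map euclideanreal (Euclidean_space n) h"
        unfolding h_def continuous_map_componentwise_Euclidean_space by auto
      then have "open {t. h t \<in> Euclidean_space n interior_of coord_box}"
        using openin_continuous_map_preimage[OF _ openin_interior_of] by fastforce
      moreover have "h (x i) = x" using xb by (auto simp: h_def coord_box_def fun_eq_iff)
      ultimately obtain e where e: "0 < e" "ball (x i) e \<subseteq> {t. h t \<in> Euclidean_space n interior_of coord_box}"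
        using x by (metis (mono_tags, lifting) mem_Collect_eq openE)
      have "h t \<in> coord_box" if "t \<in> ball (x i) e" for t
        using subsetD[OF e(2) that] by (auto intro: subsetD[OF interior_of_subset])
      then have "h (x i - e / 2) \<in> coord_box" "h (x i + e / 2) \<in> coord_box"
        using e(1) by (auto simp: dist_real_def)
      then have "0 \<le> h (x i - e / 2) i" "h (x i + e / 2) i \<le> real (card (sources_above (Suc i)))"
        using i by (auto simp: coord_box_def)
      then show ?thesis using e(1) i by (simp add: h_def)
    qed
    then show "x \<in> ?U" using xb by (auto simp: coord_box_def)
  qed
qed

lemma frontier_of_coord_box:
  assumes "x \<in> coord_box"
  shows "x \<in> Euclidean_space n frontier_of coord_box \<longleftrightarrow>
    (\<exists>i<n. x i = 0 \<or> x i = real (card (sources_above (Suc i))))"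
proof -
  have "coord_box \<subseteq> Euclidean_space n closure_of coord_box"
    by (rule closure_of_subset) (auto simp: coord_box_def topspace_Euclidean_space)
  then have "x \<in> Euclidean_space n frontier_of coord_box \<longleftrightarrow> x \<notin> Euclidean_space n interior_of coord_box"
    using assms by (auto simp: frontier_of_def)
  then show ?thesis
    using assms unfolding interior_of_coord_box by (force simp: coord_box_def)
qed

text \<open>A missing bump puts the cell into a facet where a coordinate is \<open>0\<close>, a
  missing dip into the opposite facet by flow conservation, and a missing source-edge makes the cell
  empty. Conversely, positive weights on a covering clique give a point on no facet.\<close>

lemma cell_interior_iff:
  assumes K: "clique s K"
  shows "\<not> cell K \<subseteq> Euclidean_space n frontier_of cube_sum s \<longleftrightarrow> (\<forall>e\<in>arcs G. \<exists>P\<in>K. e \<in> set P)"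
proof -
  have KR: "K \<subseteq> routes s" using K by (auto simp: clique_iff)
  have coord: "0 \<le> real N * flow K \<mu> (Suc i, 0)" "0 \<le> real N * flow K \<mu> (Suc i, part s (Suc i))"
    "real N * flow K \<mu> (Suc i, 0) + real N * flow K \<mu> (Suc i, part s (Suc i)) = real (card (sources_above (Suc i)))"
    if "\<forall>P\<in>K. 0 \<le> \<mu> P" "\<forall>e\<in>S. flow K \<mu> e = 1 / real N" "i < n" for \<mu> i
  proof -
    show "0 \<le> real N * flow K \<mu> (Suc i, 0)" "0 \<le> real N * flow K \<mu> (Suc i, part s (Suc i))"
      using that flow_nonneg by auto
    have "flow K \<mu> (Suc i, 0) + flow K \<mu> (Suc i, part s (Suc i)) = real (card (sources_above (Suc i))) / real N"
      using flow_dip[OF KR, of "Suc i" \<mu>] that by simp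
    then show "real N * flow K \<mu> (Suc i, 0) + real N * flow K \<mu> (Suc i, part s (Suc i)) =
        real (card (sources_above (Suc i)))"
      using N_pos by (simp add: field_simps)
  qed
  have in_box: "x \<in> coord_box" if "x \<in> cell K" for x
  proof -
    obtain \<mu> where "\<forall>P\<in>K. 0 \<le> \<mu> P" "\<forall>e\<in>S. flow K \<mu> e = 1 / real N"
      "x = (\<lambda>i. if i < n then real N * flow K \<mu> (Suc i, 0) else 0)"
      using \<open>x \<in> cell K\<close> unfolding mem_cell_iff[OF KR] by blast
    then show ?thesis using coord[of \<mu>] by (fastforce simp: coord_box_def)
  qed
  show ?thesis
  proof
    assume "\<not> cell K \<subseteq> Euclidean_space n frontier_of cube_sum s"
    then obtain x where x: "x \<in> cell K" "x \<notin> Euclidean_space n frontier_of coord_box"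
      unfolding cube_sum_eq_coord_box by blast
    then obtain \<mu> where \<mu>: "\<forall>P\<in>K. 0 \<le> \<mu> P" "\<forall>e\<in>S. flow K \<mu> e = 1 / real N"
      "x = (\<lambda>i. if i < n then real N * flow K \<mu> (Suc i, 0) else 0)"
      unfolding mem_cell_iff[OF KR] by blast
    have xi: "x i \<noteq> 0" "x i \<noteq> real (card (sources_above (Suc i)))" if "i < n" for i
      using x(2) frontier_of_coord_box[OF in_box[OF x(1)]] that by auto
    show "\<forall>e\<in>arcs G. \<exists>P\<in>K. e \<in> set P"
    proof (rule ccontr)
      assume "\<not> (\<forall>e\<in>arcs G. \<exists>P\<in>K. e \<in> set P)"
      then obtain e where e: "e \<in> arcs G" "\<And>P. P \<in> K \<Longrightarrow> e \<notin> set P" by blast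
      have zero: "flow K \<mu> e = 0" using e(2) by (rule flow_eq_0)
      from e(1) show False
      proof (cases rule: arcs_cases)
        case 1
        then show False using \<mu>(2) zero N_pos by auto
      next
        case 2
        then obtain i where "fst e = Suc i" by (cases "fst e") auto
        then have i: "i < n" "e = (Suc i, 0) \<or> e = (Suc i, part s (Suc i))"
          using 2 by (auto simp: prod_eq_iff)
        then show False
          using xi[OF i(1)] zero coord(3)[OF \<mu>(1,2) i(1)] \<mu>(3) by auto
      qed
    qed
  next
    assume cover: "\<forall>e\<in>arcs G. \<exists>P\<in>K. e \<in> set P"
    then have src: "\<exists>P\<in>K. e \<in> set P" if "e \<in> S" for e
      using that source_arcI by blast
    obtain \<mu> where \<mu>: "\<And>P. P \<in> K \<Longrightarrow> 0 < \<mu> P" "sum \<mu> K = 1" "\<And>e. e \<in> S \<Longrightarrow> flow K \<mu> e = 1 / real N"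
      using positive_weights[OF KR src] by blast
    define x where "x = (\<lambda>i. if i < n then real N * flow K \<mu> (Suc i, 0) else 0)"
    have xc: "x \<in> cell K"
      using \<mu> by (auto simp: mem_cell_iff[OF KR] x_def less_imp_le intro!: exI[of _ \<mu>])
    have pos: "0 < flow K \<mu> e" if e: "e \<in> arcs G" for e
    proof -
      obtain P where P: "P \<in> K" "e \<in> set P" using bspec[OF cover e] by blast
      show ?thesis by (rule flow_pos[OF clique_finite[OF K] _ P]) (rule \<mu>(1))
    qed
    have "x i \<noteq> 0 \<and> x i \<noteq> real (card (sources_above (Suc i)))" if i: "i < n" for i
    proof -
      have "(Suc i, 0) \<in> arcs G" "(Suc i, part s (Suc i)) \<in> arcs G"
        using inner_arcI(1)[of "(Suc i, 0)"] inner_arcI(1)[of "(Suc i, part s (Suc i))"] i by auto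
      then have "0 < real N * flow K \<mu> (Suc i, 0)" "0 < real N * flow K \<mu> (Suc i, part s (Suc i))"
        using pos N_pos by simp_all
      then show ?thesis
        using coord(3)[of \<mu> i] \<mu> i N_pos by (auto simp: x_def less_imp_le)
    qed
    then have "x \<notin> Euclidean_space n frontier_of cube_sum s"
      unfolding cube_sum_eq_coord_box frontier_of_coord_box[OF in_box[OF xc]] by blast
    then show "\<not> cell K \<subseteq> Euclidean_space n frontier_of cube_sum s" using xc by blast
  qed
qed

lemma interior_cells_eq: "interior_cells s = cell ` {K. clique s K \<and> (\<forall>e\<in>arcs G. \<exists>P\<in>K. e \<in> set P)}"
proof -
  have "mixed_subdivision s = cell ` {K. clique s K}"
    by (auto simp: mixed_subdivision_def DKK_triangulation_def cell_def)
  then have "interior_cells s = cell ` {K. clique s K \<and> \<not> cell K \<subseteq> Euclidean_space n frontier_of cube_sum s}"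
    unfolding interior_cells_def by blast
  moreover have "{K. clique s K \<and> \<not> cell K \<subseteq> Euclidean_space n frontier_of cube_sum s} =
      {K. clique s K \<and> (\<forall>e\<in>arcs G. \<exists>P\<in>K. e \<in> set P)}"
    using cell_interior_iff by (intro Collect_cong conj_cong) auto
  ultimately show ?thesis by simp
qed

lemma face_poset_iso:
  "\<exists>\<phi>. bij_betw \<phi> (perm_faces s) (interior_cells s) \<and>
     (\<forall>F\<in>perm_faces s. \<forall>F'\<in>perm_faces s. face_le s F F' \<longleftrightarrow> \<phi> F' \<subseteq> \<phi> F)"
proof -
  define \<phi> where "\<phi> = (\<lambda>(w, A). cell (face_routes w A))"
  have face: "stirling s w" "A \<subseteq> ascents w" "clique s (face_routes w A)"
    "\<And>e. e \<in> arcs G \<Longrightarrow> \<exists>P\<in>face_routes w A. e \<in> set P" if "(w, A) \<in> perm_faces s" for w A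
    using that face_routes_clique[of w A] face_routes_cover[of w A] by (auto simp: perm_faces_def)
  have sub: "cell (face_routes w' A') \<subseteq> cell (face_routes w A) \<longleftrightarrow> face_routes w' A' \<subseteq> face_routes w A"
    if F: "(w, A) \<in> perm_faces s" and F': "(w', A') \<in> perm_faces s" for w A w' A'
  proof
    assume "cell (face_routes w' A') \<subseteq> cell (face_routes w A)"
    then show "face_routes w' A' \<subseteq> face_routes w A"
      using cell_subset_imp_subset[OF face(3)[OF F'] face(4)[OF F'] face(3)[OF F]] source_arcI by blast
  qed (rule cell_mono)
  have order: "face_le s F F' \<longleftrightarrow> \<phi> F' \<subseteq> \<phi> F" if "F \<in> perm_faces s" "F' \<in> perm_faces s" for F F'
    using that sub face_le_iff by (cases F; cases F') (simp add: \<phi>_def)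
  have "inj_on \<phi> (perm_faces s)"
  proof (rule inj_onI)
    fix F F' assume F: "F \<in> perm_faces s" "F' \<in> perm_faces s" "\<phi> F = \<phi> F'"
    obtain w A w' A' where eq: "F = (w, A)" "F' = (w', A')" by fastforce
    have "face_routes w A = face_routes w' A'"
      using sub[of w A w' A'] sub[of w' A' w A] F eq by (auto simp: \<phi>_def)
    then show "F = F'" using face_routes_inj[of w A w' A'] F eq by simp
  qed
  moreover have "\<phi> ` perm_faces s = interior_cells s"
  proof (intro equalityI subsetI)
    fix C assume "C \<in> \<phi> ` perm_faces s"
    then obtain w A where "(w, A) \<in> perm_faces s" "C = cell (face_routes w A)"
      by (auto simp: \<phi>_def)
    then show "C \<in> interior_cells s" unfolding interior_cells_eq using face(3,4) by blast
  next
    fix C assume "C \<in> interior_cells s"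
    then obtain K where K: "clique s K" "\<forall>e\<in>arcs G. \<exists>P\<in>K. e \<in> set P" "C = cell K"
      unfolding interior_cells_eq by blast
    then obtain w A where "(w, A) \<in> perm_faces s" "face_routes w A = K"
      using cover_imp_face[OF K(1)] by blast
    then show "C \<in> \<phi> ` perm_faces s" using K(3) by (force simp: \<phi>_def)
  qed
  ultimately show ?thesis
    using order by (auto simp: bij_betw_def)
qed

end

theorem theorem4p3:
  fixes s :: "nat list"
  assumes "\<forall>k\<in>set s. 0 < k"
  shows "\<exists>\<phi>. bij_betw \<phi> (perm_faces s) (interior_cells s) \<and>
           (\<forall>F\<in>perm_faces s. \<forall>F'\<in>perm_faces s. face_le s F F' \<longleftrightarrow> \<phi> F' \<subseteq> \<phi> F)"
  using composition.face_poset_iso[OF composition.intro[OF assms]] .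

end
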